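(* Let $q,a$ be complex numbers with $0<|q|<1$, $a\neq 0$ and $a\notin\{q^m: m\in\mathbb{Z}\}$. Let $k$ be a positive integer, put $\kappa=3k-1$ and, for nonnegative integers $n_1,\dots,n_{k-1}$, $N_j=n_j+n_{j+1}+\cdots+n_{k-1}$. Then $$\sum_{n=0}^{\infty}\frac{(q;q)_{2n}\, q^n}{(a;q)_{n+1}(q/a;q)_n}\sum_{n_1,\dots,n_{k-1}=0}^{\infty}\frac{q^{N_1^2+\cdots+N_{k-1}^2+N_1+\cdots+N_{k-1}}}{(q;q)_{n-N_1}(q;q)_{n_1}\cdots(q;q)_{n_{k-2}}(q;q)_{2n_{k-1}}}$$ $$=\sum_{n=0}^{\infty} (-1)^n a^{3n} q^{(2\kappa-3)(3n+1)n/2}\bigl(1-a^2 q^{(2\kappa-3)(2n+1)}\bigr)$$ $$\quad+\sum_{i=1}^{\kappa-1}(-1)^{i+1} a^i q^{\binom{i}{2}}\frac{(q^i,q^{2\kappa-i},q^{2\kappa};q^{2\kappa})_{\infty}(q^{2\kappa-2i},q^{2\kappa+2i};q^{4\kappa})_{\infty}}{(q,a,q/a;q)_{\infty}}$$ $$\qquad\times\Bigl[1-\sum_{n=1}^{\infty}a^{2\kappa n-2i}q^{(2\kappa-3)(\kappa n-i)n}\bigl(1-a^{2i}q^{2(2\kappa-3)in}\bigr)\Bigr].$$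
   Context: Notation: $(x;q)_\infty=\prod_{j=0}^\infty(1-xq^j)$; $(x;q)_n=(x;q)_\infty/(xq^n;q)_\infty$ for all integers $n$ (so $(x;q)_n=\prod_{j=0}^{n-1}(1-xq^j)$ for $n\ge 0$), and $1/(q;q)_n=0$ for negative $n$; $(x_1,\dots,x_m;q)_n=(x_1;q)_n\cdots(x_m;q)_n$ (also for $n=\infty$). $\binom{i}{2}=i(i-1)/2$. For $k=1$ the inner sum (over $n_1,\dots,n_{k-1}$) is interpreted as $1/(q;q)_{2n}$; for $k=2$ the product $(q;q)_{n_1}\cdots(q;q)_{n_{k-2}}$ is empty, equal to $1$. *)

theory Defs
  imports "HOL-Analysis.Analysis"
begin

text \<open>
  The symbol (x;q)_\<infinity>. The convergence notion behind \<^term>\<open>prodinf\<close> admits finitely many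
  vanishing factors, so the value is 0 if x = q^(-j) for some j.
\<close>

definition qpoch_inf :: "complex \<Rightarrow> complex \<Rightarrow> complex" where
  "qpoch_inf x q = (\<Prod>j. 1 - x * q ^ j)"

definition qpochs_inf :: "complex list \<Rightarrow> complex \<Rightarrow> complex" where
  "qpochs_inf xs q = (\<Prod>x\<leftarrow>xs. qpoch_inf x q)"

text \<open>The symbol (x;q)_n for an integer n.\<close>

definition qpoch :: "complex \<Rightarrow> complex \<Rightarrow> int \<Rightarrow> complex" where
  "qpoch x q n = qpoch_inf x q / qpoch_inf (x * q powi n) q"

text \<open>The symbol 1/(q;q)_n, with the convention that it vanishes for negative n.\<close>

definition inv_qfact :: "complex \<Rightarrow> int \<Rightarrow> complex" where
  "inv_qfact q n = (if n < 0 then 0 else 1 / qpoch q q n)"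

definition tail_sum :: "nat \<Rightarrow> (nat \<Rightarrow> nat) \<Rightarrow> nat \<Rightarrow> nat" where
  "tail_sum k \<nu> j = (\<Sum>i\<in>{j..<k}. \<nu> i)"

text \<open>
  The inner multiple sum. The tuple (n_1,...,n_(k-1)) is a function \<open>\<nu>\<close> on \<open>{1..<k}\<close>, extended by
  \<^term>\<open>undefined\<close>, and N_j is \<open>tail_sum k \<nu> j\<close>. All terms with N_1 > n vanish, so that
  only finitely many terms are nonzero.
\<close>

definition inner_sum :: "nat \<Rightarrow> complex \<Rightarrow> nat \<Rightarrow> complex" where
  "inner_sum k q n =
     (if k = 1 then 1 / qpoch q q (2 * int n)
      else \<Sum>\<^sub>\<infinity>\<nu>\<in>{1..<k} \<rightarrow>\<^sub>E UNIV.
             q ^ ((\<Sum>j\<in>{1..<k}. (tail_sum k \<nu> j)\<^sup>2) + (\<Sum>j\<in>{1..<k}. tail_sum k \<nu> j))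
             * inv_qfact q (int n - int (tail_sum k \<nu> 1))
             / ((\<Prod>j\<in>{1..<k - 1}. qpoch q q (int (\<nu> j))) * qpoch q q (2 * int (\<nu> (k - 1)))))"

lemma convergent_prod_qpoch:
  fixes x q :: complex
  assumes "norm q < 1"
  shows "convergent_prod (\<lambda>j. 1 - x * q ^ j)"
proof -
  have "summable (\<lambda>j. norm x * norm q ^ j)"
    using assms by (intro summable_mult summable_geometric) auto
  hence "summable (\<lambda>j. norm (1 - x * q ^ j - 1))"
    by (simp add: norm_mult norm_power)
  thus ?thesis
    by (intro abs_convergent_prod_imp_convergent_prod)
       (simp add: abs_convergent_prod_conv_summable)
qed

lemma qpoch_inf_split:
  assumes "norm q < 1"
  shows "qpoch_inf x q = (\<Prod>j<n. 1 - x * q ^ j) * qpoch_inf (x * q ^ n) q"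
proof (induction n)
  case (Suc n)
  let ?f = "\<lambda>j. 1 - x * q ^ n * q ^ j" and ?g = "\<lambda>j. 1 - x * q ^ Suc n * q ^ j"
  have f: "(\<lambda>m. \<Prod>j\<le>Suc m. ?f j) \<longlonglongrightarrow> qpoch_inf (x * q ^ n) q"
    unfolding qpoch_inf_def
    by (rule LIMSEQ_Suc[OF convergent_prod_LIMSEQ[OF convergent_prod_qpoch[OF assms]]])
  have "(\<lambda>m. ?f 0 * (\<Prod>j\<le>m. ?g j)) \<longlonglongrightarrow> ?f 0 * qpoch_inf (x * q ^ Suc n) q"
    unfolding qpoch_inf_def
    by (intro tendsto_mult tendsto_const convergent_prod_LIMSEQ convergent_prod_qpoch[OF assms])
  moreover have "(\<Prod>j\<le>Suc m. ?f j) = ?f 0 * (\<Prod>j\<le>m. ?g j)" for m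
    by (subst prod.atMost_Suc_shift) (simp add: mult_ac)
  ultimately have "qpoch_inf (x * q ^ n) q = (1 - x * q ^ n) * qpoch_inf (x * q ^ Suc n) q"
    using f LIMSEQ_unique by (metis (no_types, lifting) ext mult.right_neutral power_0)
  with Suc show ?case by simp
qed simp

lemma qpoch_of_nat:
  assumes "norm q < 1" "qpoch_inf (x * q ^ n) q \<noteq> 0"
  shows "qpoch x q (int n) = (\<Prod>j<n. 1 - x * q ^ j)"
  using qpoch_inf_split[OF assms(1), of x n] assms(2) by (simp add: qpoch_def)

end

theory Submission
  imports Defs
begin

text \<open>
  In terms of \<open>D\<^sub>m(n) = 1 / ((q;q)\<^sub>n\<^sub>-\<^sub>m (q;q)\<^sub>n\<^sub>+\<^sub>m\<^sub>+\<^sub>1)\<close>, the number \<open>1/(q;q)\<^sub>2\<^sub>n\<close> is a combination of the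
  \<open>D\<^sub>3\<^sub>s(n)\<close> over integers s, and by the q-Vandermonde sum each further summation in the inner sum merely
  multiplies the coefficient of \<open>D\<^sub>m\<close> by a power of q (a Bailey chain). This leaves the sums
  \<open>G\<^sub>m = \<Sum>\<^sub>n V\<^sub>n q\<^sup>n D\<^sub>m(n)\<close> with \<open>V\<^sub>n = (q;q)\<^sub>2\<^sub>n / ((a;q)\<^sub>n\<^sub>+\<^sub>1 (q/a;q)\<^sub>n)\<close>. Up to elementary factors they
  satisfy a three-term recurrence in m with constant coefficients and a Gaussian right-hand side, of
  which there is only one rapidly decaying solution; it is a combination of partial theta functions.
  The inhomogeneity at m = 0 yields Jacobi's triple product on the way.

  Inserting this solution, the pure powers of a give the first series of the theorem. The remaining
  double series is \<open>\<Sum>\<^sub>j (-a)\<^sup>j q^(j(j-1)/2) P(j)\<close> up to a factor, where P is antisymmetric and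
  quasi-periodic with period \<open>2\<kappa>\<close>. Collecting \<open>j \<equiv> \<plusminus>i\<close> modulo \<open>2\<kappa>\<close> gives the second sum, and the quintuple
  product identity evaluates P(i).
\<close>

text \<open>Origin of \<kappa>: with N = 6k - 5 the summand over s carries q^(N s(3s+1)/2).
  Splitting binom(3s+1 +- j, 2) releases binom(3s+1, 2) = 3 s(3s+1)/2, which raises N to N + 3 =
  2\<kappa>; so 2\<kappa> - 3 belongs to the pure powers of a and 2\<kappa> to the theta products.

  Two obstacles shape the proof. The solution \<open>W\<close> of the recurrence is not odd under m
  -> -1-m, whereas \<open>w\<close>, the rescaled G, is; hence \<open>w = K * W\<close> is available
  only for m >= 0. There \<open>W m\<close> is cut into (-a)^m theta(a) and a remainder
  \<open>R\<close> that is odd. As K theta(a) = 1, the first piece is a pure power, and its odd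
  extension \<open>e\<close> carries the decomposition to negative m.

  Second, the double series over s and j has to be summed in both orders, although q^binom(3s+1-j,
  2) gives no decay near j = 3s+1. There only the Gaussian in s, present because N > 0, beats the
  growth of a^j.\<close>

lemma sum_int_telescope:
  fixes H :: "int \<Rightarrow> 'a::ab_group_add"
  shows "(\<Sum>s\<in>{- int L..int L}. H (s + 1) - H s) = H (int L + 1) - H (- int L)"
proof (induction L)
  case (Suc L)
  have "{- int (Suc L)..int (Suc L)} =
      insert (- int (Suc L)) (insert (int (Suc L)) {- int L..int L})" by auto
  then show ?case by (simp add: Suc add.commute)
qed simp

lemma has_sum_int_neutral:
  fixes f :: "int \<Rightarrow> complex"
  assumes "\<And>s. \<bar>s\<bar> > int L \<Longrightarrow> f s = 0"
  shows "(f has_sum (\<Sum>s\<in>{- int L..int L}. f s)) UNIV"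
  by (rule has_sum_finite_neutralI) (use assms in \<open>auto simp: abs_if split: if_splits\<close>)

lemma powi_neg_Suc: "(- z) powi (- 1 - int j) = (- 1 / z) ^ Suc j" if "z \<noteq> 0" for z :: complex
proof -
  have "- 1 - int j = - int (Suc j)" by simp
  then have "(- z) powi (- 1 - int j) = inverse ((- z) ^ Suc j)"
    by (metis power_int_minus power_int_of_nat)
  also have "\<dots> = (- 1 / z) ^ Suc j"
    unfolding power_inverse[symmetric] using that by (simp add: divide_inverse)
  finally show ?thesis .
qed

lemma powi_uminus_even: "(- x) powi (2 * m) = x powi (2 * m)" for x :: complex
proof -
  have "(- x) powi (2 * m) = ((- x) powi 2) powi m" by (rule power_int_mult)
  also have "\<dots> = (x powi 2) powi m" by simp
  also have "\<dots> = x powi (2 * m)" by (rule power_int_mult[symmetric])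
  finally show ?thesis .
qed

lemma neg_one_powi_even: "even m \<Longrightarrow> (- 1 :: complex) powi (m + n) = (- 1) powi n"
  by (auto simp: power_int_add power_int_mult elim!: evenE)

lemma neg_one_powi_Suc: "(- 1 :: complex) powi (n + 1) = - ((- 1) powi n)"
  by (simp add: power_int_add)

lemma infsum_int_shift: "(\<Sum>\<^sub>\<infinity>l. f (l + c)) = (\<Sum>\<^sub>\<infinity>l. f l)" for f :: "int \<Rightarrow> complex"
proof -
  have "bij_betw (\<lambda>l. l + c) UNIV UNIV" by (rule bij_betwI[where g = "\<lambda>l. l - c"]) auto
  then show ?thesis by (rule infsum_reindex_bij_betw)
qed

lemma infsum_int_reflect: "(\<Sum>\<^sub>\<infinity>l. f (c - l)) = (\<Sum>\<^sub>\<infinity>l. f l)" for f :: "int \<Rightarrow> complex"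
proof -
  have "bij_betw (\<lambda>l. c - l) UNIV UNIV" by (rule bij_betwI[where g = "\<lambda>l. c - l"]) auto
  then show ?thesis by (rule infsum_reindex_bij_betw)
qed

lemma qpoch_inf_nonzero:
  assumes "norm q < 1" "\<And>j. x * q ^ j \<noteq> 1"
  shows "qpoch_inf x q \<noteq> 0"
  unfolding qpoch_inf_def
  using prodinf_nonzero[OF convergent_prod_qpoch[OF assms(1), of x]] assms(2) by (metis right_minus_eq)

section \<open>Reciprocal q-factorials, the kernel D and the two WZ-type summations\<close>

locale nome =
  fixes q :: complex
  assumes norm_q_pos: "0 < norm q" and norm_q_less_1: "norm q < 1"
begin

lemma q_nonzero [simp]: "q \<noteq> 0"
  using norm_q_pos by auto

lemma power_q_neq_1: "n > 0 \<Longrightarrow> q ^ n \<noteq> 1"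
  using norm_q_less_1 norm_q_pos power_less_one_iff[of "norm q" n]
  by (metis norm_ge_zero norm_one norm_power not_gr0 order_less_irrefl)

lemma powi_q_neq_1: "n \<noteq> 0 \<Longrightarrow> q powi n \<noteq> 1"
  using power_q_neq_1[of "nat n"] power_q_neq_1[of "nat (- n)"]
  by (auto simp: power_int_def power_inverse)

lemma qpoch_inf_q_nonzero: "qpoch_inf (q * q ^ n) q \<noteq> 0"
  by (rule qpoch_inf_nonzero[OF norm_q_less_1])
     (metis power_q_neq_1 power_Suc power_add zero_less_Suc add_Suc)

lemma qpoch_q_of_nat: "qpoch q q (int n) = (\<Prod>j<n. 1 - q ^ Suc j)"
  by (subst qpoch_of_nat[OF norm_q_less_1 qpoch_inf_q_nonzero]) simp

lemma inv_qfact_neg [simp]: "n < 0 \<Longrightarrow> inv_qfact q n = 0"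
  by (simp add: inv_qfact_def)

lemma inv_qfact_0 [simp]: "inv_qfact q 0 = 1"
  using qpoch_q_of_nat[of 0] by (simp add: inv_qfact_def)

lemma inv_qfact_of_nat: "inv_qfact q (int n) = 1 / qpoch q q (int n)"
  by (simp add: inv_qfact_def)

text \<open>The convention at negative arguments is consistent with the recursion: at n = -1 the
  factor 1 - q^0 vanishes. Later computations therefore need no case distinction on signs.\<close>

lemma inv_qfact_rec: "inv_qfact q n = (1 - q powi (n + 1)) * inv_qfact q (n + 1)"
proof (cases "n \<ge> 0")
  case True
  then obtain k where k: "n = int k" by (metis nonneg_int_cases)
  have nz: "1 - q ^ Suc k \<noteq> 0" using power_q_neq_1[of "Suc k"] by auto
  have n1: "n + 1 = int (Suc k)" by (simp add: k)
  show ?thesis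
    unfolding n1 power_int_of_nat unfolding k inv_qfact_of_nat qpoch_q_of_nat
    using nz by (simp del: power_Suc)
next
  case False
  then show ?thesis by (cases "n = -1") auto
qed

lemma inv_qfact_pred: "inv_qfact q (n - 1) = (1 - q powi n) * inv_qfact q n"
  using inv_qfact_rec[of "n - 1"] by simp

text \<open>Up to a factor 1 - q this is the kernel of a Bailey pair relative to q. Writing
  (q;q)_(n+m+1) in place of (q^2;q)_(n+m) makes it symmetric under m -> -1-m.\<close>

definition D :: "int \<Rightarrow> int \<Rightarrow> complex" where
  "D m n = inv_qfact q (n - m) * inv_qfact q (n + m + 1)"

lemma D_reflect: "D (- 1 - m) n = D m n"
  by (simp add: D_def algebra_simps)

lemma D_eq_0: "n < m \<or> n < - 1 - m \<Longrightarrow> D m n = 0"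
  by (auto simp: D_def)

lemma D_pred: "D m (n - 1) = (1 - q powi (n - m)) * (1 - q powi (n + m + 1)) * D m n"
proof -
  have "n - 1 - m = (n - m) - 1" "n - 1 + m + 1 = (n + m + 1) - 1" by auto
  then show ?thesis unfolding D_def by (simp only: inv_qfact_pred mult_ac)
qed

text \<open>The right-hand side telescopes in N: a WZ certificate.\<close>

lemma vandermonde_step:
  "q powi (N\<^sup>2 + N) * inv_qfact q (n - N) * D r N * ((1 - q powi (n - r)) * (1 - q powi (n + r + 1)))
   - q powi (N\<^sup>2 + N) * inv_qfact q (n - 1 - N) * D r N =
   - (q powi (n - (N + 1)) * q powi ((N + 1)\<^sup>2 + (N + 1)) * inv_qfact q (n - (N + 1)) * D r N)
   + q powi (n - N) * q powi (N\<^sup>2 + N) * inv_qfact q (n - N) * D r (N - 1)"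
proof -
  have e: "n - (N + 1) = n - N - 1" "n - 1 - N = n - N - 1" by auto
  have e2: "q powi ((N + 1)\<^sup>2 + (N + 1)) = q powi (N\<^sup>2 + N) * (q powi N)^2 * q^2"
  proof -
    have "(N + 1)\<^sup>2 + (N + 1) = (N\<^sup>2 + N) + (N + (N + 2))" by (simp add: power2_eq_square algebra_simps)
    then have "q powi ((N + 1)\<^sup>2 + (N + 1)) = q powi (N\<^sup>2 + N) * (q powi N * (q powi N * q powi 2))"
      by (simp only: power_int_add q_nonzero simp_thms)
    then show ?thesis by (simp add: power2_eq_square)
  qed
  show ?thesis
    unfolding e inv_qfact_pred D_pred e2
    by (simp add: power_int_add power_int_diff field_simps power2_eq_square)
qed

text \<open>Induction on d = n - r; at d = 0 only the term N = r survives. Multiplication by c takes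
  both sides from n to n - 1: the right one by \<open>D_pred\<close>, the left one by telescoping
  \<open>vandermonde_step\<close>.\<close>

lemma vandermonde_aux:
  "(\<Sum>N\<le>r + d. q ^ (N\<^sup>2 + N) * inv_qfact q (int (r + d) - int N) * D (int r) (int N))
    = q ^ (r\<^sup>2 + r) * D (int r) (int (r + d))"
proof (induction d)
  case 0
  have "(\<Sum>N\<le>r. q ^ (N\<^sup>2 + N) * inv_qfact q (int r - int N) * D (int r) (int N))
      = (\<Sum>N\<in>{r}. q ^ (N\<^sup>2 + N) * inv_qfact q (int r - int N) * D (int r) (int N))"
    by (rule sum.mono_neutral_right) (auto intro!: D_eq_0)
  then show ?case by simp
next
  case (Suc d)
  define n where "n = r + Suc d"
  define c where "c = (1 - q powi (int n - int r)) * (1 - q powi (int n + int r + 1))"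
  have c: "c \<noteq> 0"
    unfolding c_def using powi_q_neq_1[of "int n - int r"] powi_q_neq_1[of "int n + int r + 1"]
    by (auto simp: n_def)
  define t where "t N n = q powi (N\<^sup>2 + N) * inv_qfact q (n - N) * D (int r) N" for N n :: int
  define H where "H N = - (q powi (int n - N) * q powi (N\<^sup>2 + N) * inv_qfact q (int n - N) * D (int r) (N - 1))" for N
  have tq: "q ^ (N\<^sup>2 + N) * inv_qfact q (int n' - int N) * D (int r) (int N) = t (int N) (int n')" for N n'
    by (simp add: t_def flip: power_int_of_nat)
  have step: "c * t N n - t N (int n - 1) = H (N + 1) - H N" for N :: int
    using vandermonde_step[of N "int n" "int r"] by (simp add: c_def t_def H_def algebra_simps)
  have "(\<Sum>N\<le>n. c * t (int N) n - t (int N) (int n - 1)) = (\<Sum>N\<le>n. H (int (Suc N)) - H (int N))"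
    by (intro sum.cong refl) (simp add: step algebra_simps)
  also have "\<dots> = H (int (Suc n)) - H 0"
    unfolding lessThan_Suc_atMost[symmetric] sum_lessThan_telescope[of "\<lambda>i. H (int i)"] by simp
  \<comment> \<open>At n + 1 the factor \<open>inv_qfact q (-1)\<close> vanishes, at 0 the factor
    \<open>D r (-1)\<close>.\<close>
  also have "\<dots> = 0" by (simp add: H_def D_eq_0)
  finally have "c * (\<Sum>N\<le>n. t (int N) n) = (\<Sum>N\<le>n. t (int N) (int n - 1))"
    by (simp add: sum_subtractf sum_distrib_left)
  also have "\<dots> = (\<Sum>N\<le>r + d. t (int N) (int (r + d)))"
    by (simp add: n_def t_def)
  also have "\<dots> = q ^ (r\<^sup>2 + r) * D (int r) (int n - 1)"
    using Suc.IH unfolding tq by (simp add: n_def)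
  also have "\<dots> = c * (q ^ (r\<^sup>2 + r) * D (int r) (int n))"
    by (simp add: D_pred c_def)
  finally show ?case using c unfolding n_def[symmetric] tq by (simp only: mult_left_cancel simp_thms)
qed

text \<open>Negative r reduces to -1-r >= 0, because both the kernel and r^2 + r are invariant under
  this reflection.\<close>

lemma q_vandermonde:
  "(\<Sum>N\<le>n. q ^ (N\<^sup>2 + N) * inv_qfact q (int n - int N) * D r (int N)) = q powi (r\<^sup>2 + r) * D r (int n)"
proof -
  have nat: "(\<Sum>N\<le>n. q ^ (N\<^sup>2 + N) * inv_qfact q (int n - int N) * D (int r) (int N))
    = q ^ (r\<^sup>2 + r) * D (int r) (int n)" for r
  proof (cases "r \<le> n")
    case True
    then show ?thesis using vandermonde_aux[of r "n - r"] by simp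
  next
    case False
    then show ?thesis by (simp add: D_eq_0)
  qed
  show ?thesis
  proof (cases "r \<ge> 0")
    case True
    then obtain k where "r = int k" by (metis nonneg_int_cases)
    then show ?thesis using nat[of k] by (simp flip: power_int_of_nat)
  next
    case False
    then have "- 1 - r = int (nat (- 1 - r))" by simp
    then obtain k where k: "- 1 - r = int k" by blast
    have "int (k\<^sup>2 + k) = (- 1 - r)\<^sup>2 + (- 1 - r)" by (simp add: k)
    also have "\<dots> = r\<^sup>2 + r" by (simp add: power2_eq_square algebra_simps)
    finally have "q powi (r\<^sup>2 + r) = q ^ (k\<^sup>2 + k)" by (metis power_int_of_nat)
    moreover have "D (int k) j = D r j" for j using D_reflect[of r] by (simp only: k)
    ultimately show ?thesis using nat[of k] by simp
  qed
qed

text \<open>The coefficients of 1/(q;q)_(2n) in the kernels D_(3s). By \<open>D_reflect\<close> a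
  negative s contributes at index 3|s| - 1, so this is a Bailey pair with no terms at indices
  congruent to 1 modulo 3.\<close>

definition A0 :: "int \<Rightarrow> complex" where
  "A0 s = q powi (6 * s\<^sup>2 - s) * (1 - q powi (6 * s + 1))"

text \<open>Here H is the WZ certificate for the expansion of \<open>1/(q;q)\<^sub>2\<^sub>n\<close>.\<close>

lemma triple_step:
  defines "H \<equiv> \<lambda>n s. - (q powi (n + 1 - 3 * s + 6 * s\<^sup>2 - s)) * inv_qfact q (n + 1 - 3 * s) * inv_qfact q (n - 1 + 3 * s)"
  shows "(1 - q powi (2 * n + 1)) * (1 - q powi (2 * n + 2)) * (A0 s * D (3 * s) (n + 1)) - A0 s * D (3 * s) n
    = H n (s + 1) - H n s"
proof -
  define I J E where "I = inv_qfact q (n + 1 - 3 * s)" and "J = inv_qfact q (n + 3 * s + 2)"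
    and "E = q powi (6 * s\<^sup>2 - s)"
  \<comment> \<open>All powers of q that occur are monomials in q, Y and T, which leaves an identity
    between rational functions in these three.\<close>
  define Y T where "Y = q powi (n - 3 * s)" and "T = q powi (6 * s)"
  have p: "q powi (i + (n - 3 * s) * b + 6 * s * c) = q powi i * Y powi b * T powi c" for i b c
    by (simp add: power_int_add power_int_mult Y_def T_def)
  have P: "q powi (2 * n + 1) = Y^2 * T * q" "q powi (2 * n + 2) = Y^2 * T * q^2"
    "q powi (n + 1 - 3 * s) = Y * q" "q powi (n - 3 * s) = Y" "q powi (n - 3 * s - 1) = Y / q"
    "q powi (n + 3 * s + 2) = Y * T * q^2" "q powi (n + 3 * s + 1) = Y * T * q" "q powi (n + 3 * s) = Y * T"
    "q powi (n + 9 * s + 3) = Y * T^2 * q^3" "q powi (6 * s + 1) = T * q"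
    using p[of 1 2 1] p[of 2 2 1] p[of 1 1 0] p[of 0 1 0] p[of "-1" 1 0] p[of 2 1 1] p[of 1 1 1] p[of 0 1 1]
      p[of 3 1 2] p[of 1 0 1]
    by (simp_all add: algebra_simps power_int_minus divide_inverse)
  have I1: "inv_qfact q (n - 3 * s) = (1 - Y * q) * I"
    using inv_qfact_rec[of "n - 3 * s"] unfolding P(3)[symmetric] by (simp add: I_def algebra_simps)
  have I2: "inv_qfact q (n - 3 * s - 1) = (1 - Y) * inv_qfact q (n - 3 * s)"
    unfolding P(4)[symmetric] by (rule inv_qfact_pred)
  have I3: "inv_qfact q (n - 3 * s - 2) = (1 - Y / q) * inv_qfact q (n - 3 * s - 1)"
    using inv_qfact_pred[of "n - 3 * s - 1"] unfolding P(5)[symmetric] by (simp add: algebra_simps)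
  have J1: "inv_qfact q (n + 3 * s + 1) = (1 - Y * T * q^2) * J"
    using inv_qfact_rec[of "n + 3 * s + 1"] unfolding P(6)[symmetric] by (simp add: J_def algebra_simps)
  have J2: "inv_qfact q (n + 3 * s) = (1 - Y * T * q) * inv_qfact q (n + 3 * s + 1)"
    unfolding P(7)[symmetric] by (rule inv_qfact_rec)
  have J3: "inv_qfact q (n - 1 + 3 * s) = (1 - Y * T) * inv_qfact q (n + 3 * s)"
    using inv_qfact_pred[of "n + 3 * s"] unfolding P(8)[symmetric] by (simp add: algebra_simps)
  have D1: "D (3 * s) (n + 1) = I * J" by (simp add: D_def I_def J_def algebra_simps)
  have D2: "D (3 * s) n = inv_qfact q (n - 3 * s) * inv_qfact q (n + 3 * s + 1)" by (simp add: D_def)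
  have H1: "H n (s + 1) = - (E * (Y * T^2 * q^3)) * inv_qfact q (n - 3 * s - 2) * J"
  proof -
    have "n + 1 - 3 * (s + 1) + 6 * (s + 1)\<^sup>2 - (s + 1) = (6 * s\<^sup>2 - s) + (n + 9 * s + 3)"
      by (simp add: power2_eq_square algebra_simps)
    moreover have "n + 1 - 3 * (s + 1) = n - 3 * s - 2" "n - 1 + 3 * (s + 1) = n + 3 * s + 2" by auto
    ultimately show ?thesis
      unfolding H_def E_def J_def P(9)[symmetric] by (simp only: power_int_add q_nonzero simp_thms)
  qed
  have H2: "H n s = - (E * (Y * q)) * I * inv_qfact q (n - 1 + 3 * s)"
  proof -
    have "n + 1 - 3 * s + 6 * s\<^sup>2 - s = (6 * s\<^sup>2 - s) + (n + 1 - 3 * s)" by simp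
    then show ?thesis
      unfolding H_def E_def I_def P(3)[symmetric] by (simp only: power_int_add q_nonzero simp_thms)
  qed
  have A: "A0 s = E * (1 - T * q)"
    unfolding A0_def E_def P ..
  \<comment> \<open>The only denominator sits in 1 - Y/q; the factor q^3 next to it clears it, after
    which \<open>algebra\<close> applies.\<close>
  define Z where "Z = 1 - Y / q"
  have Z: "q^3 * Z = q\<^sup>2 * (q - Y)"
    by (simp add: Z_def field_simps power2_eq_square power3_eq_cube)
  have "H n (s + 1) - H n s =
    E * I * J * (- (Y * T^2) * (q^3 * Z) * (1 - Y) * (1 - Y * q) + Y * q * (1 - Y * T) * (1 - Y * T * q) * (1 - Y * T * q^2))"
    unfolding H1 H2 J3 I3 J2 I2 J1 I1 Z_def[symmetric] by algebra
  also have "\<dots> = E * I * J * ((1 - Y^2 * T * q) * (1 - Y^2 * T * q^2) * (1 - T * q) - (1 - T * q) * (1 - Y * q) * (1 - Y * T * q^2))"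
    unfolding Z by algebra
  also have "\<dots> = (1 - q powi (2 * n + 1)) * (1 - q powi (2 * n + 2)) * (A0 s * D (3 * s) (n + 1)) - A0 s * D (3 * s) n"
    unfolding D1 D2 A J1 I1 P(1,2) by algebra
  finally show ?thesis ..
qed

text \<open>Induction on n with the range of s fixed by a common bound L, so that the sums for n and
  n + 1 can be compared termwise.\<close>

lemma triple_sum_aux:
  assumes "n \<le> L"
  shows "1 / qpoch q q (2 * int n) = (\<Sum>s\<in>{- int L..int L}. A0 s * D (3 * s) (int n))"
  using assms
proof (induction n)
  case 0
  have "(\<Sum>s\<in>{- int L..int L}. A0 s * D (3 * s) 0) = (\<Sum>s\<in>{0}. A0 s * D (3 * s) 0)"
    by (rule sum.mono_neutral_right) (auto intro!: D_eq_0)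
  also have "\<dots> = 1"
    using inv_qfact_rec[of 0] by (simp add: A0_def D_def)
  finally show ?case using inv_qfact_of_nat[of 0] by simp
next
  case (Suc n)
  define c where "c = (1 - q powi (2 * int n + 1)) * (1 - q powi (2 * int n + 2))"
  define H where "H s = - (q powi (int n + 1 - 3 * s + 6 * s\<^sup>2 - s)) * inv_qfact q (int n + 1 - 3 * s)
    * inv_qfact q (int n - 1 + 3 * s)" for s
  have "c \<noteq> 0"
    unfolding c_def using powi_q_neq_1[of "2 * int n + 1"] powi_q_neq_1[of "2 * int n + 2"] by auto
  have "(\<Sum>s\<in>{- int L..int L}. c * (A0 s * D (3 * s) (int n + 1)) - A0 s * D (3 * s) (int n)) =
     (\<Sum>s\<in>{- int L..int L}. H (s + 1) - H s)"
    unfolding c_def H_def triple_step ..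
  also have "\<dots> = H (int L + 1) - H (- int L)" by (rule sum_int_telescope)
  \<comment> \<open>Since n + 1 <= L, each end of the telescoped sum contains a reciprocal
    q-factorial of a negative number.\<close>
  also have "\<dots> = 0" using Suc.prems by (simp add: H_def)
  finally have "c * (\<Sum>s\<in>{- int L..int L}. A0 s * D (3 * s) (int n + 1)) = 1 / qpoch q q (2 * int n)"
    using Suc by (simp add: sum_subtractf sum_distrib_left)
  moreover have "1 / qpoch q q (2 * int n) = c * (1 / qpoch q q (2 * int (Suc n)))"
  proof -
    have "inv_qfact q (2 * int n) = c * inv_qfact q (2 * int n + 2)"
      using inv_qfact_rec[of "2 * int n"] inv_qfact_rec[of "2 * int n + 1"]
      by (simp add: c_def add.commute)
    then show ?thesis
      using inv_qfact_of_nat[of "2 * n"] inv_qfact_of_nat[of "2 * n + 2"] by (simp add: algebra_simps)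
  qed
  ultimately have "c * (1 / qpoch q q (2 * int (Suc n))) = c * (\<Sum>s\<in>{- int L..int L}. A0 s * D (3 * s) (int n + 1))"
    by (simp only:)
  moreover have "int n + 1 = int (Suc n)" by simp
  ultimately show ?case using \<open>c \<noteq> 0\<close> mult_left_cancel by metis
qed

end

section \<open>The inner multiple sum as an iterated sum\<close>

definition bounded_tuples :: "nat \<Rightarrow> nat \<Rightarrow> (nat \<Rightarrow> nat) set" where
  "bounded_tuples k n = {\<nu> \<in> {1..<k} \<rightarrow>\<^sub>E UNIV. tail_sum k \<nu> 1 \<le> n}"

lemma finite_bounded_tuples: "finite (bounded_tuples k n)"
proof (rule finite_subset)
  show "bounded_tuples k n \<subseteq> {1..<k} \<rightarrow>\<^sub>E {..n}"
  proof
    fix \<nu> assume \<nu>: "\<nu> \<in> bounded_tuples k n"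
    have "\<nu> j \<le> n" if "j \<in> {1..<k}" for j
    proof -
      have "\<nu> j \<le> (\<Sum>i\<in>{1..<k}. \<nu> i)" using that by (intro member_le_sum) auto
      then show ?thesis using \<nu> by (simp add: bounded_tuples_def tail_sum_def)
    qed
    then show "\<nu> \<in> {1..<k} \<rightarrow>\<^sub>E {..n}"
      using \<nu> by (auto simp: bounded_tuples_def PiE_iff)
  qed
qed (auto intro: finite_PiE)

definition tl_tuple :: "nat \<Rightarrow> (nat \<Rightarrow> nat) \<Rightarrow> nat \<Rightarrow> nat" where
  "tl_tuple k \<nu> = restrict (\<lambda>j. \<nu> (Suc j)) {1..<k}"

text \<open>Parametrised by the new tail sum N_1 = N instead of the new entry n_1, which is
  therefore N minus the old tail sum.\<close>

definition cons_tuple :: "nat \<Rightarrow> nat \<Rightarrow> (nat \<Rightarrow> nat) \<Rightarrow> nat \<Rightarrow> nat" where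
  "cons_tuple k N \<nu> =
     restrict (\<lambda>j. if j = 1 then N - tail_sum k \<nu> 1 else \<nu> (j - 1)) {1..<Suc k}"

lemma tail_sum_Suc: "1 \<le> j \<Longrightarrow> tail_sum (Suc k) \<nu> (Suc j) = tail_sum k (tl_tuple k \<nu>) j"
  unfolding tail_sum_def sum.shift_bounds_Suc_ivl
  by (intro sum.cong) (auto simp: tl_tuple_def)

lemma tail_sum_Suc_1: "1 \<le> k \<Longrightarrow> tail_sum (Suc k) \<nu> 1 = \<nu> 1 + tail_sum k (tl_tuple k \<nu>) 1"
  using tail_sum_Suc[of 1 k \<nu>] sum.atLeast_Suc_lessThan[of 1 "Suc k" \<nu>]
  by (simp add: tail_sum_def)

lemma tl_cons_tuple:
  assumes "\<nu> \<in> {1..<k} \<rightarrow>\<^sub>E UNIV"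
  shows "tl_tuple k (cons_tuple k N \<nu>) = \<nu>"
proof
  fix j show "tl_tuple k (cons_tuple k N \<nu>) j = \<nu> j"
    using assms by (auto simp: tl_tuple_def cons_tuple_def PiE_iff extensional_def)
qed

context nome
begin

definition inner_term :: "nat \<Rightarrow> nat \<Rightarrow> (nat \<Rightarrow> nat) \<Rightarrow> complex" where
  "inner_term k n \<nu> = (if k = 1 then 1 / qpoch q q (2 * int n) else
     q ^ ((\<Sum>j\<in>{1..<k}. (tail_sum k \<nu> j)\<^sup>2) + (\<Sum>j\<in>{1..<k}. tail_sum k \<nu> j))
             * inv_qfact q (int n - int (tail_sum k \<nu> 1))
             / ((\<Prod>j\<in>{1..<k - 1}. qpoch q q (int (\<nu> j))) * qpoch q q (2 * int (\<nu> (k - 1)))))"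

text \<open>The case k = 1 fits as well: there is then exactly one (empty) tuple, with tail sum
  0.\<close>

lemma inner_sum_finite:
  assumes "k \<ge> 1"
  shows "inner_sum k q n = (\<Sum>\<nu>\<in>bounded_tuples k n. inner_term k n \<nu>)"
proof (cases "k = 1")
  case True
  have "bounded_tuples 1 n = {\<lambda>_. undefined}" by (auto simp: bounded_tuples_def tail_sum_def)
  then show ?thesis using True by (simp add: inner_sum_def inner_term_def)
next
  case False
  have "inner_sum k q n = infsum (inner_term k n) ({1..<k} \<rightarrow>\<^sub>E UNIV)"
    using False by (simp add: inner_sum_def inner_term_def [abs_def])
  also have "\<dots> = infsum (inner_term k n) (bounded_tuples k n)"
    by (rule infsum_cong_neutral) (use False in \<open>auto simp: bounded_tuples_def inner_term_def\<close>)
  also have "\<dots> = (\<Sum>\<nu>\<in>bounded_tuples k n. inner_term k n \<nu>)"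
    by (rule infsum_finite[OF finite_bounded_tuples])
  finally show ?thesis .
qed

text \<open>Since n_1 = N_1 - N_2, the denominator (q;q)_(n_1) is the leading factor of the term for
  k with n replaced by N_1. For k = 1 the remaining factor 1/(q;q)_(2 n_1) is that term
  itself.\<close>

lemma inner_term_Suc:
  assumes "k \<ge> 1"
  defines "N \<equiv> \<lambda>\<nu>. tail_sum (Suc k) \<nu> 1"
  shows "inner_term (Suc k) n \<nu> =
    q ^ ((N \<nu>)\<^sup>2 + N \<nu>) * inv_qfact q (int n - int (N \<nu>)) * inner_term k (N \<nu>) (tl_tuple k \<nu>)"
proof (cases "k = 1")
  case True
  have "N \<nu> = \<nu> 1" by (simp add: N_def tail_sum_def True)
  then show ?thesis by (simp add: inner_term_def True N_def)
next
  case False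
  then have k: "k \<ge> 2" using assms by simp
  let ?\<mu> = "tl_tuple k \<nu>"
  have sum: "(\<Sum>j\<in>{1..<Suc k}. g (tail_sum (Suc k) \<nu> j)) = g (N \<nu>) + (\<Sum>j\<in>{1..<k}. g (tail_sum k ?\<mu> j))" for g :: "nat \<Rightarrow> nat"
  proof -
    have "(\<Sum>j\<in>{1..<Suc k}. g (tail_sum (Suc k) \<nu> j)) = g (N \<nu>) + (\<Sum>j\<in>{Suc 1..<Suc k}. g (tail_sum (Suc k) \<nu> j))"
      unfolding N_def using assms(1) by (intro sum.atLeast_Suc_lessThan) auto
    also have "(\<Sum>j\<in>{Suc 1..<Suc k}. g (tail_sum (Suc k) \<nu> j)) = (\<Sum>j\<in>{1..<k}. g (tail_sum k ?\<mu> j))"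
      unfolding sum.shift_bounds_Suc_ivl by (intro sum.cong refl) (simp add: tail_sum_Suc)
    finally show ?thesis .
  qed
  have prod: "(\<Prod>j\<in>{1..<k}. qpoch q q (int (\<nu> j))) =
    qpoch q q (int (\<nu> 1)) * (\<Prod>j\<in>{1..<k - 1}. qpoch q q (int (?\<mu> j)))"
  proof -
    have "(\<Prod>j\<in>{1..<k}. qpoch q q (int (\<nu> j))) =
      qpoch q q (int (\<nu> 1)) * (\<Prod>j\<in>{Suc 1..<Suc (k - 1)}. qpoch q q (int (\<nu> j)))"
      using k prod.atLeast_Suc_lessThan[of 1 k "\<lambda>j. qpoch q q (int (\<nu> j))"] by simp
    also have "(\<Prod>j\<in>{Suc 1..<Suc (k - 1)}. qpoch q q (int (\<nu> j))) = (\<Prod>j\<in>{1..<k - 1}. qpoch q q (int (?\<mu> j)))"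
      unfolding prod.shift_bounds_Suc_ivl by (intro prod.cong refl) (auto simp: tl_tuple_def)
    finally show ?thesis .
  qed
  have last: "?\<mu> (k - 1) = \<nu> k" using k by (auto simp: tl_tuple_def)
  have "int (N \<nu>) - int (tail_sum k ?\<mu> 1) = int (\<nu> 1)"
    using tail_sum_Suc_1[OF assms(1), of \<nu>] by (simp add: N_def)
  then have iq: "inv_qfact q (int (N \<nu>) - int (tail_sum k ?\<mu> 1)) = 1 / qpoch q q (int (\<nu> 1))"
    by (simp only: inv_qfact_of_nat)
  have L: "inner_term (Suc k) n \<nu> =
    q ^ ((\<Sum>j\<in>{1..<Suc k}. (tail_sum (Suc k) \<nu> j)\<^sup>2) + (\<Sum>j\<in>{1..<Suc k}. tail_sum (Suc k) \<nu> j))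
             * inv_qfact q (int n - int (N \<nu>))
             / ((\<Prod>j\<in>{1..<k}. qpoch q q (int (\<nu> j))) * qpoch q q (2 * int (\<nu> k)))"
    unfolding inner_term_def N_def using assms(1) by simp
  have R: "inner_term k (N \<nu>) ?\<mu> =
    q ^ ((\<Sum>j\<in>{1..<k}. (tail_sum k ?\<mu> j)\<^sup>2) + (\<Sum>j\<in>{1..<k}. tail_sum k ?\<mu> j))
             * inv_qfact q (int (N \<nu>) - int (tail_sum k ?\<mu> 1))
             / ((\<Prod>j\<in>{1..<k - 1}. qpoch q q (int (?\<mu> j))) * qpoch q q (2 * int (?\<mu> (k - 1))))"
    unfolding inner_term_def using False by simp
  show ?thesis
    unfolding L R sum[of "\<lambda>x. x\<^sup>2"] sum[of "\<lambda>x. x"] prod last iq by (simp add: power_add mult_ac)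
qed

text \<open>Tuples are grouped by N = N_1; what remains is the tail, an arbitrary shorter tuple
  whose own tail sum is at most N.\<close>

lemma inner_sum_Suc:
  assumes "k \<ge> 1"
  shows "inner_sum (Suc k) q n =
    (\<Sum>N\<le>n. q ^ (N\<^sup>2 + N) * inv_qfact q (int n - int N) * inner_sum k q N)"
proof -
  let ?h = "\<lambda>N. q ^ (N\<^sup>2 + N) * inv_qfact q (int n - int N)"
  have "(\<Sum>N\<le>n. ?h N * inner_sum k q N) =
    (\<Sum>N\<le>n. \<Sum>\<nu>\<in>bounded_tuples k N. ?h N * inner_term k N \<nu>)"
    by (simp add: inner_sum_finite[OF assms] sum_distrib_left)
  also have "\<dots> = (\<Sum>(N, \<nu>)\<in>Sigma {..n} (bounded_tuples k). ?h N * inner_term k N \<nu>)"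
    by (rule sum.Sigma) (auto simp: finite_bounded_tuples)
  also have "\<dots> = (\<Sum>\<nu>\<in>bounded_tuples (Suc k) n. inner_term (Suc k) n \<nu>)"
  proof (rule sum.reindex_bij_witness[where i = "\<lambda>\<nu>. (tail_sum (Suc k) \<nu> 1, tl_tuple k \<nu>)"
      and j = "\<lambda>(N, \<nu>). cons_tuple k N \<nu>"])
    fix x assume "x \<in> Sigma {..n} (bounded_tuples k)"
    then obtain N \<nu> where x: "x = (N, \<nu>)" "N \<le> n" "\<nu> \<in> bounded_tuples k N" by auto
    have 1: "tl_tuple k (cons_tuple k N \<nu>) = \<nu>"
      using x by (intro tl_cons_tuple) (auto simp: bounded_tuples_def)
    have 2: "tail_sum (Suc k) (cons_tuple k N \<nu>) 1 = N"
    proof -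
      have "cons_tuple k N \<nu> 1 = N - tail_sum k \<nu> 1" using assms by (simp add: cons_tuple_def)
      then show ?thesis
        using x(3) unfolding tail_sum_Suc_1[OF assms] 1 by (simp add: bounded_tuples_def)
    qed
    show "(tail_sum (Suc k) (case x of (N, \<nu>) \<Rightarrow> cons_tuple k N \<nu>) 1,
         tl_tuple k (case x of (N, \<nu>) \<Rightarrow> cons_tuple k N \<nu>)) = x"
      using 1 2 x by simp
    show "(case x of (N, \<nu>) \<Rightarrow> cons_tuple k N \<nu>) \<in> bounded_tuples (Suc k) n"
      using 2 x by (simp add: bounded_tuples_def) (simp add: cons_tuple_def)
    show "inner_term (Suc k) n (case x of (N, \<nu>) \<Rightarrow> cons_tuple k N \<nu>) = (case x of (N, \<nu>) \<Rightarrow> ?h N * inner_term k N \<nu>)"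
      using 1 2 x by (simp add: inner_term_Suc[OF assms])
  next
    fix \<nu> assume \<nu>: "\<nu> \<in> bounded_tuples (Suc k) n"
    show "(case (tail_sum (Suc k) \<nu> 1, tl_tuple k \<nu>) of (N, \<nu>) \<Rightarrow> cons_tuple k N \<nu>) = \<nu>"
    proof
      fix j
      show "(case (tail_sum (Suc k) \<nu> 1, tl_tuple k \<nu>) of (N, \<nu>) \<Rightarrow> cons_tuple k N \<nu>) j = \<nu> j"
        using \<nu> assms tail_sum_Suc_1[OF assms, of \<nu>]
        by (auto simp: cons_tuple_def bounded_tuples_def PiE_iff extensional_def tl_tuple_def)
    qed
    show "(tail_sum (Suc k) \<nu> 1, tl_tuple k \<nu>) \<in> Sigma {..n} (bounded_tuples k)"
      using \<nu> tail_sum_Suc_1[OF assms, of \<nu>] by (auto simp: bounded_tuples_def) (auto simp: tl_tuple_def)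
  qed
  also have "\<dots> = inner_sum (Suc k) q n" by (simp add: inner_sum_finite)
  finally show ?thesis ..
qed

definition A :: "nat \<Rightarrow> int \<Rightarrow> complex" where
  "A k s = q powi (((3 * s)\<^sup>2 + 3 * s) * (int k - 1)) * A0 s"

text \<open>The common bound L makes the range of s independent of N <= n, so the two finite sums
  can be exchanged before \<open>q_vandermonde\<close> is applied at r = 3s.\<close>

lemma inner_sum_expansion_aux:
  assumes "k \<ge> 1" "n \<le> L"
  shows "inner_sum k q n = (\<Sum>s\<in>{- int L..int L}. A k s * D (3 * s) (int n))"
  using assms
proof (induction k arbitrary: n rule: dec_induct)
  case base
  then show ?case using triple_sum_aux[of n L] by (simp add: A_def inner_sum_def)
next
  case (step k)
  let ?h = "\<lambda>N. q ^ (N\<^sup>2 + N) * inv_qfact q (int n - int N)"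
  have A: "A (Suc k) s = q powi ((3 * s)\<^sup>2 + 3 * s) * A k s" for s
  proof -
    have "((3 * s)\<^sup>2 + 3 * s) * (int (Suc k) - 1) = ((3 * s)\<^sup>2 + 3 * s) + ((3 * s)\<^sup>2 + 3 * s) * (int k - 1)"
      by (simp add: algebra_simps)
    then show ?thesis unfolding A_def by (simp only: power_int_add q_nonzero simp_thms mult.assoc)
  qed
  have "inner_sum (Suc k) q n = (\<Sum>N\<le>n. ?h N * (\<Sum>s\<in>{- int L..int L}. A k s * D (3 * s) (int N)))"
    using step by (simp add: inner_sum_Suc)
  also have "\<dots> = (\<Sum>s\<in>{- int L..int L}. A k s * (\<Sum>N\<le>n. ?h N * D (3 * s) (int N)))"
    unfolding sum_distrib_left by (subst sum.swap) (simp add: mult_ac)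
  also have "\<dots> = (\<Sum>s\<in>{- int L..int L}. A (Suc k) s * D (3 * s) (int n))"
    unfolding q_vandermonde A by (simp add: mult_ac)
  finally show ?case .
qed

lemma inner_sum_expansion:
  assumes "k \<ge> 1"
  shows "((\<lambda>s. A k s * D (3 * s) (int n)) has_sum inner_sum k q n) UNIV"
  unfolding inner_sum_expansion_aux[OF assms order_refl]
  by (rule has_sum_int_neutral) (auto intro!: D_eq_0 simp: abs_if split: if_splits)

end

section \<open>The binomial binom(n,2) at all integers, and absolutely summable series\<close>

definition tri :: "int \<Rightarrow> int" where
  "tri n = n * (n - 1) div 2"

lemma two_tri: "2 * tri n = n * (n - 1)"
proof -
  have "even (n * (n - 1))" by simp
  then show ?thesis unfolding tri_def by simp
qed

lemma tri_add: "tri (m + n) = tri m + tri n + m * n"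
proof -
  have "2 * tri (m + n) = 2 * (tri m + tri n + m * n)"
    unfolding distrib_left two_tri by (simp add: algebra_simps)
  then show ?thesis by simp
qed

lemma tri_0 [simp]: "tri 0 = 0" and tri_1 [simp]: "tri 1 = 0"
  by (simp_all add: tri_def)

lemma tri_add_1: "tri (n + 1) = tri n + n"
  by (simp add: tri_add)

lemma tri_reflect: "tri (1 - n) = tri n"
proof -
  have "2 * tri (1 - n) = 2 * tri n"
    unfolding two_tri by (simp add: algebra_simps)
  then show ?thesis by simp
qed

lemma tri_uminus: "tri (- n) = tri n + n"
  using tri_reflect[of "n + 1"] tri_add_1[of n] by simp

abbreviation abs_summable :: "('a \<Rightarrow> complex) \<Rightarrow> 'a set \<Rightarrow> bool" where
  "abs_summable f B \<equiv> (\<lambda>x. norm (f x)) summable_on B"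

text \<open>The two half-lines overlap at 0, which is harmless for summability. For the value of a
  sum, \<open>infsum_int_split\<close> uses the disjoint halves j and -1-j.\<close>

lemma abs_summable_on_int:
  fixes f :: "int \<Rightarrow> complex"
  assumes "summable (\<lambda>n. norm (f (int n)))" "summable (\<lambda>n. norm (f (- int n)))"
  shows "abs_summable f UNIV"
proof -
  have "abs_summable f (range int)"
    using norm_summable_imp_summable_on[of "\<lambda>n. norm (f (int n))"] assms(1)
    by (subst summable_on_reindex) (auto simp: o_def)
  moreover have "abs_summable f (range (\<lambda>n. - int n))"
    using norm_summable_imp_summable_on[of "\<lambda>n. norm (f (- int n))"] assms(2)
    by (subst summable_on_reindex) (auto simp: o_def inj_on_def)
  ultimately have "abs_summable f (range int \<union> range (\<lambda>n. - int n))"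
    by (rule summable_on_union)
  moreover have "x \<in> range int \<union> range (\<lambda>n. - int n)" for x
    by (cases x rule: int_cases2) auto
  then have "range int \<union> range (\<lambda>n. - int n) = UNIV" by blast
  ultimately show ?thesis by simp
qed


lemma infsum_int_split:
  fixes f :: "int \<Rightarrow> complex"
  assumes "abs_summable f UNIV"
  shows "(\<Sum>\<^sub>\<infinity>j. f j) = (\<Sum>j. f (int j)) + (\<Sum>j. f (- 1 - int j))"
    and "summable (\<lambda>j. f (int j))" and "summable (\<lambda>j. f (- 1 - int j))"
proof -
  have s: "f summable_on B" for B
    using assms abs_summable_summable summable_on_subset_banach by blast
  have *: "(\<Sum>\<^sub>\<infinity>x\<in>range g. f x) = (\<Sum>j. f (g j)) \<and> summable (\<lambda>j. f (g j))" if "inj g" for g :: "nat \<Rightarrow> int"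
  proof -
    have "(\<lambda>j. f (g j)) summable_on UNIV"
      using s[of "range g"] summable_on_reindex[OF that, of f] by (simp add: o_def)
    moreover have "infsum f (range g) = infsum (\<lambda>j. f (g j)) UNIV"
      using infsum_reindex[OF that, of f] by (simp add: o_def)
    ultimately show ?thesis
      by (metis has_sum_infsum has_sum_imp_sums sums_unique sums_summable)
  qed
  have u: "UNIV = range int \<union> range (\<lambda>j. - 1 - int j)"
  proof -
    have "x \<in> range int \<union> range (\<lambda>j. - 1 - int j)" for x
    proof (cases "x \<ge> 0")
      case True then show ?thesis by (metis UnI1 nonneg_int_cases rangeI)
    next
      case False
      then have "x = - 1 - int (nat (- 1 - x))" by simp
      then show ?thesis by blast
    qed
    then show ?thesis by blast
  qed
  have "(\<Sum>\<^sub>\<infinity>j. f j) = infsum f (range int) + infsum f (range (\<lambda>j. - 1 - int j))"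
    unfolding u by (rule infsum_Un_disjoint[OF s s]) auto
  then show "(\<Sum>\<^sub>\<infinity>j. f j) = (\<Sum>j. f (int j)) + (\<Sum>j. f (- 1 - int j))"
    using *[of int] *[of "\<lambda>j. - 1 - int j"] by (simp add: inj_on_def)
  show "summable (\<lambda>j. f (int j))" "summable (\<lambda>j. f (- 1 - int j))"
    using *[of int] *[of "\<lambda>j. - 1 - int j"] by (simp_all add: inj_on_def)
qed

lemma abs_summable_on_mult_Times:
  fixes f :: "'a \<Rightarrow> complex" and g :: "'b \<Rightarrow> complex"
  assumes "abs_summable f B" "abs_summable g C"
  shows "abs_summable (\<lambda>(x, y). f x * g y) (B \<times> C)"
proof -
  have "(\<lambda>y. norm (f x * g y)) summable_on C" for x
    using assms(2) by (simp add: norm_mult summable_on_cmult_right)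
  moreover have "(\<lambda>x. norm (infsum (\<lambda>y. norm (f x * g y)) C)) summable_on B"
    using assms(1)
    by (simp add: norm_mult infsum_cmult_right' summable_on_cmult_left abs_mult infsum_nonneg)
  ultimately show ?thesis
    by (subst Infinite_Sum.abs_summable_on_Sigma_iff) auto
qed

section \<open>Gaussian series, partial theta functions and the theta function\<close>

context nome
begin

abbreviation t :: "int \<Rightarrow> complex" where
  "t m \<equiv> q powi tri m"

lemma t_add: "t (m + n) = t m * t n * q powi (m * n)"
  by (simp add: tri_add power_int_add)

lemma t_add_1: "t (n + 1) = t n * q powi n"
  by (simp add: tri_add_1 power_int_add)

lemma norm_powi_le_1: "n \<ge> 0 \<Longrightarrow> norm (q powi n) \<le> 1"
  using norm_q_less_1 by (auto simp: power_int_def norm_power power_le_one)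

text \<open>The ratio of consecutive terms is c q^n, which tends to 0 for every c.\<close>

lemma gauss_summable_nat:
  "summable (\<lambda>n. norm (c ^ n * t (int n)))"
proof -
  have "(\<lambda>n. norm c * norm q ^ n) \<longlonglongrightarrow> norm c * 0"
    using norm_q_less_1 by (intro tendsto_mult tendsto_const LIMSEQ_realpow_zero) auto
  then have "eventually (\<lambda>n. norm c * norm q ^ n < 1 / 2) sequentially"
    by (intro order_tendstoD) auto
  then obtain N where N: "\<And>n. n \<ge> N \<Longrightarrow> norm c * norm q ^ n < 1 / 2"
    by (auto simp: eventually_sequentially)
  show ?thesis
  proof (rule summable_ratio_test[of "1 / 2" N])
    fix n assume "N \<le> n"
    have "t (int (Suc n)) = t (int n) * q ^ n"
      using t_add_1[of "int n"] by (simp add: add.commute)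
    then have "norm (norm (c ^ Suc n * t (int (Suc n)))) = (norm c * norm q ^ n) * norm (c ^ n * t (int n))"
      by (simp add: norm_mult norm_power)
    also have "\<dots> \<le> 1 / 2 * norm (c ^ n * t (int n))"
      by (intro mult_right_mono less_imp_le[OF N[OF \<open>N \<le> n\<close>]]) auto
    finally show "norm (norm (c ^ Suc n * t (int (Suc n)))) \<le> 1 / 2 * norm (norm (c ^ n * t (int n)))"
      by simp
  qed simp
qed

lemma gauss_summable:
  assumes "c \<noteq> 0"
  shows "abs_summable (\<lambda>n. c powi n * t n) UNIV"
proof (rule abs_summable_on_int)
  show "summable (\<lambda>n. norm (c powi int n * t (int n)))"
    using gauss_summable_nat[of c] by simp
  have "c powi (- int n) * t (- int n) = (q / c) ^ n * t (int n)" for n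
    using assms by (simp add: tri_uminus power_int_add power_int_minus field_simps)
  then show "summable (\<lambda>n. norm (c powi (- int n) * t (- int n)))"
    using gauss_summable_nat[of "q / c"] by simp
qed

text \<open>One half of a theta series, begun at binom(m+1,2). It solves the first-order recurrence
  f(m-1) = t(m) + c f(m) and decays like t(m+1) as m grows.\<close>

definition partial_theta :: "complex \<Rightarrow> int \<Rightarrow> complex" where
  "partial_theta c m = (\<Sum>j. c ^ j * t (m + 1 + int j))"

lemma partial_theta_summable: "summable (\<lambda>j. norm (c ^ j * t (m + int j)))"
proof -
  have "c ^ j * t (m + int j) = t m * ((c * q powi m) ^ j * t (int j))" for j
    by (simp add: t_add power_int_mult power_mult_distrib)
  then show ?thesis
    using summable_mult[OF gauss_summable_nat[of "c * q powi m"], of "norm (t m)"]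
    by (simp add: norm_mult)
qed

lemma partial_theta_rec: "partial_theta c m = t (m + 1) + c * partial_theta c (m + 1)"
proof -
  have "partial_theta c m = c ^ 0 * t (m + 1 + int 0) + (\<Sum>j. c ^ Suc j * t (m + 1 + int (Suc j)))"
    unfolding partial_theta_def using suminf_split_head[OF summable_norm_cancel[OF partial_theta_summable[of c "m + 1"]]] by simp
  also have "(\<Sum>j. c ^ Suc j * t (m + 1 + int (Suc j))) = (\<Sum>j. c * (c ^ j * t (m + 1 + 1 + int j)))"
    by (simp add: algebra_simps)
  also have "\<dots> = c * partial_theta c (m + 1)"
    unfolding partial_theta_def by (rule suminf_mult[OF summable_norm_cancel[OF partial_theta_summable]])
  finally show ?thesis by simp
qed

text \<open>In t(m+1+j) = t(m+1) t(j) q^((m+1)j) the cross factor has modulus at most 1. This is the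
  decay in m that the uniqueness argument requires.\<close>

lemma norm_partial_theta_le:
  assumes "m \<ge> -1"
  shows "norm (partial_theta c m) \<le> norm (t (m + 1)) * (\<Sum>j. norm (c ^ j * t (int j)))"
proof -
  have "norm (c ^ j * t (m + 1 + int j)) \<le> norm (t (m + 1)) * norm (c ^ j * t (int j))" for j
  proof -
    have "norm (c ^ j * t (m + 1 + int j)) = norm (t (m + 1)) * norm (c ^ j * t (int j)) * norm (q powi ((m + 1) * int j))"
      by (simp add: t_add[of "m + 1"] norm_mult)
    also have "\<dots> \<le> norm (t (m + 1)) * norm (c ^ j * t (int j)) * 1"
      using assms by (intro mult_left_mono norm_powi_le_1) auto
    finally show ?thesis by simp
  qed
  then have "(\<Sum>j. norm (c ^ j * t (m + 1 + int j))) \<le> (\<Sum>j. norm (t (m + 1)) * norm (c ^ j * t (int j)))"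
    by (intro suminf_le partial_theta_summable summable_mult gauss_summable_nat)
  moreover have "norm (partial_theta c m) \<le> (\<Sum>j. norm (c ^ j * t (m + 1 + int j)))"
    unfolding partial_theta_def by (rule summable_norm[OF partial_theta_summable])
  ultimately show ?thesis
    by (simp add: suminf_mult[OF gauss_summable_nat])
qed

definition theta :: "complex \<Rightarrow> complex" where
  "theta z = (\<Sum>\<^sub>\<infinity>j. (- z) powi j * t j)"

text \<open>The terms with negative index become, after reflecting binom, the second partial theta
  function without its initial term 1.\<close>

lemma theta_eq_partial_theta:
  assumes "z \<noteq> 0"
  shows "theta z = partial_theta (- z) (- 1) + partial_theta (- 1 / z) 0 - 1"
proof -
  have "theta z = (\<Sum>j. (- z) powi int j * t (int j)) + (\<Sum>j. (- z) powi (- 1 - int j) * t (- 1 - int j))"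
    unfolding theta_def using gauss_summable[of "- z"] assms by (intro infsum_int_split(1)) auto
  also have "(\<Sum>j. (- z) powi int j * t (int j)) = partial_theta (- z) (- 1)" by (simp add: partial_theta_def)
  also have "(\<lambda>j. (- z) powi (- 1 - int j) * t (- 1 - int j)) = (\<lambda>j. (- 1 / z) * ((- 1 / z) ^ j * t (0 + 1 + 1 + int j)))"
  proof
    fix j
    have 1: "t (- 1 - int j) = t (0 + 1 + 1 + int j)"
      using tri_reflect[of "- 1 - int j"] by (simp add: algebra_simps)
    show "(- z) powi (- 1 - int j) * t (- 1 - int j) = (- 1 / z) * ((- 1 / z) ^ j * t (0 + 1 + 1 + int j))"
      unfolding 1 powi_neg_Suc[OF assms] by (simp only: mult.assoc power_Suc)
  qed
  also have "(\<Sum>j. (- 1 / z) * ((- 1 / z) ^ j * t (0 + 1 + 1 + int j))) = (- 1 / z) * partial_theta (- 1 / z) (0 + 1)"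
    unfolding partial_theta_def by (rule suminf_mult[OF summable_norm_cancel[OF partial_theta_summable]])
  also have "\<dots> = partial_theta (- 1 / z) 0 - 1"
    using partial_theta_rec[of "- 1 / z" 0] by simp
  finally show ?thesis by simp
qed

text \<open>Replacing j by j + m turns t(m+1-j) into t(1-j) = t(j).\<close>

lemma theta_shift:
  assumes "z \<noteq> 0"
  shows "(\<Sum>\<^sub>\<infinity>j. (- z) powi j * t (m + 1 - j)) = (- z) powi m * theta z"
proof -
  have "(- z) powi (j + m) * t (m + 1 - (j + m)) = (- z) powi m * ((- z) powi j * t j)" for j
    using tri_reflect[of j] assms by (simp add: power_int_add)
  then have "(\<Sum>\<^sub>\<infinity>j. (- z) powi (j + m) * t (m + 1 - (j + m))) = (- z) powi m * theta z"
    unfolding theta_def by (simp add: infsum_cmult_right')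
  moreover have "bij_betw (\<lambda>j. j + m) UNIV UNIV"
    by (rule bij_betwI[where g = "\<lambda>j. j - m"]) auto
  ultimately show ?thesis
    using infsum_reindex_bij_betw[of "\<lambda>j. j + m" UNIV UNIV "\<lambda>j. (- z) powi j * t (m + 1 - j)"] by simp
qed

end

section \<open>The sums G over n and their three-term recurrence\<close>

lemma qpoch_tendsto:
  assumes "norm q < 1" "\<And>n. qpoch_inf (x * q ^ n) q \<noteq> 0"
  shows "(\<lambda>n. qpoch x q (int n)) \<longlonglongrightarrow> qpoch_inf x q"
proof -
  have "(\<lambda>n. \<Prod>j<n. 1 - x * q ^ j) \<longlonglongrightarrow> qpoch_inf x q"
    using convergent_prod_LIMSEQ[OF convergent_prod_qpoch[OF assms(1), of x]]
    unfolding qpoch_inf_def by (simp add: LIMSEQ_lessThan_iff_atMost)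
  then show ?thesis by (simp add: qpoch_of_nat[OF assms])
qed

locale nome_param = nome +
  fixes a :: complex
  assumes a_nonzero [simp]: "a \<noteq> 0" and a_neq_powi: "a \<noteq> q powi m"
begin

lemma a_q_nonzero: "1 - a * q powi m \<noteq> 0"
proof
  assume "1 - a * q powi m = 0"
  then have "a = q powi (- m)" by (simp add: power_int_minus field_simps)
  then show False using a_neq_powi by blast
qed

lemma q_a_nonzero: "1 - q powi m / a \<noteq> 0"
  using a_neq_powi[of m] by (simp add: field_simps)

lemma qpoch_inf_a_nonzero: "qpoch_inf (a * q ^ n) q \<noteq> 0"
proof (rule qpoch_inf_nonzero[OF norm_q_less_1])
  fix j show "a * q ^ n * q ^ j \<noteq> 1"
    using a_q_nonzero[of "int (n + j)"] unfolding power_int_of_nat by (simp add: power_add mult_ac)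
qed

lemma qpoch_inf_q_a_nonzero: "qpoch_inf (q / a * q ^ n) q \<noteq> 0"
proof (rule qpoch_inf_nonzero[OF norm_q_less_1])
  fix j show "q / a * q ^ n * q ^ j \<noteq> 1"
    using q_a_nonzero[of "int (Suc (n + j))"] unfolding power_int_of_nat by (simp add: power_add mult_ac)
qed

definition V :: "nat \<Rightarrow> complex" where
  "V n = qpoch q q (2 * int n) / (qpoch a q (int n + 1) * qpoch (q / a) q (int n))"

lemma V_prod:
  "V n = (\<Prod>j<2 * n. 1 - q ^ Suc j) / ((\<Prod>j<Suc n. 1 - a * q ^ j) * (\<Prod>j<n. 1 - q / a * q ^ j))"
proof -
  have "2 * int n = int (2 * n)" "int n + 1 = int (Suc n)" by simp_all
  then show ?thesis
    unfolding V_def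
    by (simp only: qpoch_q_of_nat qpoch_of_nat[OF norm_q_less_1 qpoch_inf_a_nonzero]
        qpoch_of_nat[OF norm_q_less_1 qpoch_inf_q_a_nonzero])
qed

lemma V_0: "V 0 = 1 / (1 - a)"
  by (simp add: V_prod)

lemma V_Suc:
  "(1 - a * q ^ Suc n) * (1 - q ^ Suc n / a) * V (Suc n) = (1 - q ^ (2 * n + 1)) * (1 - q ^ (2 * n + 2)) * V n"
proof -
  define P1 P2 P3 where "P1 = (\<Prod>j<2 * n. 1 - q ^ Suc j)" and "P2 = (\<Prod>j<Suc n. 1 - a * q ^ j)"
    and "P3 = (\<Prod>j<n. 1 - q / a * q ^ j)"
  define u v where "u = 1 - a * q ^ Suc n" and "v = 1 - q ^ Suc n / a"
  have nz: "u \<noteq> 0" "v \<noteq> 0"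
    using a_q_nonzero[of "int (Suc n)"] q_a_nonzero[of "int (Suc n)"]
    unfolding power_int_of_nat u_def v_def by auto
  have "V (Suc n) = P1 * ((1 - q ^ (2 * n + 1)) * (1 - q ^ (2 * n + 2))) / ((P2 * u) * (P3 * v))"
    unfolding V_prod P1_def P2_def P3_def u_def v_def by (simp add: mult.assoc)
  moreover have "V n = P1 / (P2 * P3)"
    unfolding V_prod P1_def P2_def P3_def by (rule refl)
  ultimately show ?thesis
    unfolding u_def[symmetric] v_def[symmetric] using nz by simp
qed

text \<open>It enters as the limit of the boundary terms \<open>E m n\<close>; that it is also
  1/theta(a) is only known from \<open>jacobi_triple_product_K\<close> on.\<close>

definition K :: complex where
  "K = 1 / qpochs_inf [q, a, q / a] q"

lemma qpoch_inf_q_nonzero': "qpoch_inf q q \<noteq> 0"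
  using qpoch_inf_q_nonzero[of 0] by simp

lemma V_tendsto: "V \<longlonglongrightarrow> K * (qpoch_inf q q)\<^sup>2"
proof -
  have q: "(\<lambda>n. qpoch q q (int n)) \<longlonglongrightarrow> qpoch_inf q q"
    by (rule qpoch_tendsto[OF norm_q_less_1 qpoch_inf_q_nonzero])
  have "(\<lambda>n. qpoch q q (int (2 * n))) \<longlonglongrightarrow> qpoch_inf q q"
    by (rule filterlim_compose[OF q]) (simp add: filterlim_subseq strict_mono_def)
  moreover have a: "(\<lambda>n. qpoch a q (int n)) \<longlonglongrightarrow> qpoch_inf a q"
    by (rule qpoch_tendsto[OF norm_q_less_1 qpoch_inf_a_nonzero])
  have "(\<lambda>n. qpoch a q (int (Suc n))) \<longlonglongrightarrow> qpoch_inf a q"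
    by (rule LIMSEQ_Suc[OF a])
  moreover have "(\<lambda>n. qpoch (q / a) q (int n)) \<longlonglongrightarrow> qpoch_inf (q / a) q"
    by (rule qpoch_tendsto[OF norm_q_less_1 qpoch_inf_q_a_nonzero])
  ultimately have "(\<lambda>n. qpoch q q (int (2 * n)) / (qpoch a q (int (Suc n)) * qpoch (q / a) q (int n)))
    \<longlonglongrightarrow> qpoch_inf q q / (qpoch_inf a q * qpoch_inf (q / a) q)"
    using qpoch_inf_a_nonzero[of 0] qpoch_inf_q_a_nonzero[of 0] by (intro tendsto_intros) auto
  moreover have "K * (qpoch_inf q q)\<^sup>2 = qpoch_inf q q / (qpoch_inf a q * qpoch_inf (q / a) q)"
    using qpoch_inf_q_nonzero' by (simp add: K_def qpochs_inf_def power2_eq_square)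
  moreover have "V = (\<lambda>n. qpoch q q (int (2 * n)) / (qpoch a q (int (Suc n)) * qpoch (q / a) q (int n)))"
    by (simp add: V_def fun_eq_iff add.commute)
  ultimately show ?thesis by (simp only:)
qed

lemma inv_qfact_tendsto: "(\<lambda>n. inv_qfact q (int n + m)) \<longlonglongrightarrow> 1 / qpoch_inf q q"
proof -
  have q: "(\<lambda>n. qpoch q q (int n)) \<longlonglongrightarrow> qpoch_inf q q"
    by (rule qpoch_tendsto[OF norm_q_less_1 qpoch_inf_q_nonzero])
  then have i: "(\<lambda>n. inv_qfact q (int n)) \<longlonglongrightarrow> 1 / qpoch_inf q q"
    unfolding inv_qfact_of_nat using qpoch_inf_q_nonzero' by (intro tendsto_intros)
  have "(\<lambda>n. inv_qfact q (int (nat (int n + m)))) \<longlonglongrightarrow> 1 / qpoch_inf q q"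
  proof (rule filterlim_compose[OF i])
    show "filterlim (\<lambda>n. nat (int n + m)) sequentially sequentially"
      unfolding filterlim_at_top eventually_sequentially
    proof
      fix Z show "\<exists>N. \<forall>n\<ge>N. Z \<le> nat (int n + m)"
        by (rule exI[of _ "Z + nat \<bar>m\<bar>"]) auto
    qed
  qed
  moreover have "eventually (\<lambda>n. inv_qfact q (int (nat (int n + m))) = inv_qfact q (int n + m)) sequentially"
    using eventually_ge_at_top[of "nat (- m)"] by eventually_elim simp
  ultimately show ?thesis by (rule Lim_transform_eventually)
qed

lemma V_bound: "\<exists>B>0. \<forall>n. norm (V n) \<le> B"
  using convergent_imp_Bseq[of V] V_tendsto unfolding Bseq_def convergent_def by blast

lemma inv_qfact_bound: "\<exists>B>0. \<forall>n. norm (inv_qfact q n) \<le> B"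
proof -
  have "Bseq (\<lambda>n. inv_qfact q (int n))"
    using convergent_imp_Bseq inv_qfact_tendsto[of 0] unfolding convergent_def by fastforce
  then obtain B where B: "B > 0" "\<And>n. norm (inv_qfact q (int n)) \<le> B"
    unfolding Bseq_def by blast
  have "norm (inv_qfact q n) \<le> B" for n
    using B by (cases n rule: int_cases) (auto simp: less_imp_le)
  then show ?thesis using B(1) by blast
qed

text \<open>Uniformity in m is the point: it bounds all G_m at once and gives a majorant for the
  double sum over n and s.\<close>

lemma VD_bound: "\<exists>B>0. \<forall>m n. norm (V n * q ^ n * D m (int n)) \<le> B * norm q ^ n"
proof -
  obtain B where B: "B > 0" "\<And>n. norm (V n) \<le> B" using V_bound by blast
  obtain C where C: "C > 0" "\<And>n. norm (inv_qfact q n) \<le> C" using inv_qfact_bound by blast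
  have "norm (V n * q ^ n * D m (int n)) \<le> (B * C * C) * norm q ^ n" for m n
  proof -
    have "norm (V n * q ^ n * D m (int n)) =
      norm (V n) * norm (inv_qfact q (int n - m)) * norm (inv_qfact q (int n + m + 1)) * norm q ^ n"
      by (simp add: D_def norm_mult norm_power)
    also have "\<dots> \<le> (B * C * C) * norm q ^ n"
      using B C by (intro mult_right_mono mult_mono mult_nonneg_nonneg) (auto simp: less_imp_le)
    finally show ?thesis .
  qed
  then show ?thesis using B C by (intro exI[of _ "B * C * C"]) auto
qed

definition G :: "int \<Rightarrow> complex" where
  "G m = (\<Sum>n. V n * q ^ n * D m (int n))"

lemma norm_geometric_summable: "summable (\<lambda>n. B * norm q ^ n)"
  using norm_q_less_1 by (intro summable_mult summable_geometric) auto

lemma G_summable: "summable (\<lambda>n. norm (V n * q ^ n * D m (int n)))"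
proof -
  obtain B where B: "\<And>m n. norm (V n * q ^ n * D m (int n)) \<le> B * norm q ^ n" using VD_bound by blast
  show ?thesis
    by (rule summable_comparison_test'[OF norm_geometric_summable[of B]]) (use B in auto)
qed

lemma G_sums: "(\<lambda>n. V n * q ^ n * D m (int n)) sums G m"
  unfolding G_def by (rule summable_sums[OF summable_norm_cancel[OF G_summable]])

lemma G_bound: "\<exists>B>0. \<forall>m. norm (G m) \<le> B"
proof -
  obtain B where B: "B > 0" "\<And>m n. norm (V n * q ^ n * D m (int n)) \<le> B * norm q ^ n" using VD_bound by blast
  have "norm (G m) \<le> (\<Sum>n. B * norm q ^ n)" for m
  proof -
    have "norm (G m) \<le> (\<Sum>n. norm (V n * q ^ n * D m (int n)))"
      unfolding G_def by (rule summable_norm[OF G_summable])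
    also have "\<dots> \<le> (\<Sum>n. B * norm q ^ n)"
      by (intro suminf_le B G_summable norm_geometric_summable)
    finally show ?thesis .
  qed
  moreover have "(\<Sum>n. B * norm q ^ n) > 0"
    using B(1) norm_q_pos by (intro suminf_pos norm_geometric_summable) auto
  ultimately show ?thesis by blast
qed

lemma G_reflect: "G (- 1 - m) = G m"
  by (simp add: G_def D_reflect)

text \<open>All kernels involved are polynomial multiples of F = D_m(n+1), with coefficients in q, Y
  = q^(n-m) and M = q^m. The right side is shaped for creative telescoping: times V_n q^n it becomes
  a difference in n, because \<open>V_Suc\<close> matches its two products.\<close>

lemma D_contiguous:
  "q powi m * (1 - q powi (2 * m + 3)) * D (m + 1) n + q powi (1 - m) * (1 - q powi (2 * m - 1)) * D (m - 1) n
     + (a + 1 / a) * (1 - q powi (2 * m + 1)) * D m n =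
   (1 - q powi (2 * m + 1)) * q powi (- n) *
     ((1 - q powi (2 * n + 1)) * (1 - q powi (2 * n + 2)) * D m (n + 1) - (1 - a * q powi n) * (1 - q powi n / a) * D m n)"
proof -
  define F where "F = D m (n + 1)"
  define Y M where "Y = q powi (n - m)" and "M = q powi m"
  have nz: "Y \<noteq> 0" "M \<noteq> 0" by (simp_all add: Y_def M_def)
  have p: "q powi (i + (n - m) * b + m * c) = q powi i * Y powi b * M powi c" for i b c
    by (simp add: power_int_add power_int_mult Y_def M_def)
  have P: "q powi (2 * m + 3) = M^2 * q^3" "q powi (2 * m - 1) = M^2 / q" "q powi (2 * m + 1) = M^2 * q"
    "q powi (2 * n + 1) = Y^2 * M^2 * q" "q powi (2 * n + 2) = Y^2 * M^2 * q^2"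
    "q powi (n - m + 1) = Y * q" "q powi (n + m + 1) = Y * M^2 * q"
    "q powi (n + m + 2) = Y * M^2 * q^2"
    "q powi (1 - m) = q / M" "q powi n = Y * M" "q powi (- n) = 1 / (Y * M)"
    using p[of 3 0 2] p[of "-1" 0 2] p[of 1 0 2] p[of 1 2 2] p[of 2 2 2] p[of 1 1 0] p[of 1 1 2] p[of 2 1 2]
      p[of 1 0 "-1"] p[of 0 1 1] p[of 0 "-1" "-1"]
    by (simp_all add: algebra_simps power_int_minus divide_inverse)
  have I: "inv_qfact q (n - m) = (1 - Y * q) * inv_qfact q (n - m + 1)"
    unfolding P(6)[symmetric] by (rule inv_qfact_rec)
  have I': "inv_qfact q (n - m - 1) = (1 - Y) * inv_qfact q (n - m)"
    unfolding Y_def by (rule inv_qfact_pred)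
  have J: "inv_qfact q (n + m + 1) = (1 - Y * M^2 * q^2) * inv_qfact q (n + m + 2)"
    using inv_qfact_rec[of "n + m + 1"] unfolding P(8)[symmetric] by (simp add: add.commute)
  have J': "inv_qfact q (n + m) = (1 - Y * M^2 * q) * inv_qfact q (n + m + 1)"
    unfolding P(7)[symmetric] by (rule inv_qfact_rec)
  have F: "F = inv_qfact q (n - m + 1) * inv_qfact q (n + m + 2)"
    by (simp add: F_def D_def algebra_simps)
  have D0: "D m n = (1 - Y * q) * (1 - Y * M^2 * q^2) * F"
    unfolding D_def I J F by (simp only: mult_ac)
  have D1: "D (m + 1) n = (1 - Y) * (1 - Y * q) * F"
  proof -
    have "D (m + 1) n = inv_qfact q (n - m - 1) * inv_qfact q (n + m + 2)"
      by (simp add: D_def algebra_simps)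
    then show ?thesis unfolding I' I F by (simp only: mult_ac)
  qed
  have D2: "D (m - 1) n = (1 - Y * M^2 * q) * (1 - Y * M^2 * q^2) * F"
  proof -
    have "D (m - 1) n = inv_qfact q (n - m + 1) * inv_qfact q (n + m)"
      by (simp add: D_def algebra_simps)
    then show ?thesis unfolding J' J F by (simp only: mult_ac)
  qed
  have z: "(1 - a * (Y * M)) * (1 - Y * M / a) = 1 + Y^2 * M^2 - (a + 1 / a) * (Y * M)"
    by (simp add: field_simps power2_eq_square)
  \<comment> \<open>As an indeterminate, a + 1/a does not bring a denominator into the polynomial
    identity.\<close>
  define h where "h = a + 1 / a"
  have "Y * M * (M * (1 - M^2 * q^3) * ((1 - Y) * (1 - Y * q) * F) + q / M * (1 - M^2 / q) * ((1 - Y * M^2 * q) * (1 - Y * M^2 * q^2) * F)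
     + h * (1 - M^2 * q) * ((1 - Y * q) * (1 - Y * M^2 * q^2) * F)) =
     Y * M * M * (1 - M^2 * q^3) * ((1 - Y) * (1 - Y * q) * F) + Y * (q - M^2) * ((1 - Y * M^2 * q) * (1 - Y * M^2 * q^2) * F)
     + Y * M * h * (1 - M^2 * q) * ((1 - Y * q) * (1 - Y * M^2 * q^2) * F)"
  proof -
    have "Y * M * (q / M * (1 - M^2 / q) * Z) = Y * (q - M^2) * Z" for Z
      using nz by (simp add: field_simps)
    then show ?thesis unfolding distrib_left by (simp only: mult.assoc)
  qed
  also have "\<dots> = (1 - M^2 * q) * ((1 - Y^2 * M^2 * q) * (1 - Y^2 * M^2 * q^2) * F
      - (1 + Y^2 * M^2 - h * (Y * M)) * ((1 - Y * q) * (1 - Y * M^2 * q^2) * F))"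
    by algebra
  finally have "M * (1 - M^2 * q^3) * ((1 - Y) * (1 - Y * q) * F) + q / M * (1 - M^2 / q) * ((1 - Y * M^2 * q) * (1 - Y * M^2 * q^2) * F)
     + h * (1 - M^2 * q) * ((1 - Y * q) * (1 - Y * M^2 * q^2) * F) =
     (1 - M^2 * q) * (1 / (Y * M)) * ((1 - Y^2 * M^2 * q) * (1 - Y^2 * M^2 * q^2) * F
      - (1 + Y^2 * M^2 - h * (Y * M)) * ((1 - Y * q) * (1 - Y * M^2 * q^2) * F))"
    using nz by (simp add: eq_divide_eq mult.commute)
  then show ?thesis
    unfolding P M_def[symmetric] D0 D1 D2 F_def[symmetric] z h_def .
qed

text \<open>The quantity whose differences in n are summed in the recurrence for G;
  \<open>V_Suc\<close> rewrites its value at n + 1 in terms of V_n.\<close>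

definition E :: "int \<Rightarrow> nat \<Rightarrow> complex" where
  "E m n = (1 - a * q ^ n) * (1 - q ^ n / a) * V n * D m (int n)"

lemma E_tendsto: "E m \<longlonglongrightarrow> K"
proof -
  have p: "(\<lambda>n. q ^ n) \<longlonglongrightarrow> 0" by (rule LIMSEQ_power_zero[OF norm_q_less_1])
  have "(\<lambda>n. D m (int n)) \<longlonglongrightarrow> 1 / qpoch_inf q q * (1 / qpoch_inf q q)"
    using tendsto_mult[OF inv_qfact_tendsto[of "- m"] inv_qfact_tendsto[of "m + 1"]]
    by (simp add: D_def algebra_simps)
  then have "E m \<longlonglongrightarrow> (1 - a * 0) * (1 - 0 / a) * (K * (qpoch_inf q q)\<^sup>2) * (1 / qpoch_inf q q * (1 / qpoch_inf q q))"
    unfolding E_def [abs_def] by (intro tendsto_intros p V_tendsto) simp_all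
  then show ?thesis using qpoch_inf_q_nonzero' by (simp add: power2_eq_square)
qed

lemma E_0: "E m 0 = (1 - 1 / a) * D m 0"
  using a_q_nonzero[of 0] by (simp add: E_def V_0)

lemma E_diff:
  "q powi m * (1 - q powi (2 * m + 3)) * (V n * q ^ n * D (m + 1) (int n))
     + q powi (1 - m) * (1 - q powi (2 * m - 1)) * (V n * q ^ n * D (m - 1) (int n))
     + (a + 1 / a) * (1 - q powi (2 * m + 1)) * (V n * q ^ n * D m (int n)) =
   (1 - q powi (2 * m + 1)) * (E m (Suc n) - E m n)"
proof -
  have n: "q powi (2 * int n + 1) = q ^ (2 * n + 1)" "q powi (2 * int n + 2) = q ^ (2 * n + 2)"
    "q powi (- int n) = 1 / q ^ n"
    using power_int_of_nat[of q "2 * n + 1"] power_int_of_nat[of q "2 * n + 2"]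
    by (simp_all add: power_int_minus divide_inverse add.commute)
  have E1: "E m (Suc n) = (1 - q ^ (2 * n + 1)) * (1 - q ^ (2 * n + 2)) * V n * D m (int n + 1)"
    unfolding E_def V_Suc by (simp add: add.commute)
  have E2: "E m n = (1 - a * q ^ n) * (1 - q ^ n / a) * V n * D m (int n)"
    by (simp add: E_def)
  have "?thesis \<longleftrightarrow> V n * q ^ n * (q powi m * (1 - q powi (2 * m + 3)) * D (m + 1) (int n)
     + q powi (1 - m) * (1 - q powi (2 * m - 1)) * D (m - 1) (int n)
     + (a + 1 / a) * (1 - q powi (2 * m + 1)) * D m (int n)) =
    (1 - q powi (2 * m + 1)) * (E m (Suc n) - E m n)"
    by (simp add: algebra_simps)
  moreover have "\<dots>"
    unfolding D_contiguous n E1 E2 power_int_of_nat by (simp add: right_diff_distrib del: power_Suc)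
  ultimately show ?thesis by simp
qed

text \<open>In \<open>D_contiguous\<close> the coefficients 1 - q^(2m+3) and 1 - q^(2m-1) are
  exactly this factor at m + 1 and m - 1. At m = 3s it is also the factor 1 - q^(6s+1) of
  \<open>A0\<close>.\<close>

definition y :: "int \<Rightarrow> complex" where
  "y m = (1 - q powi (2 * m + 1)) * G m"

text \<open>Summing \<open>E_diff\<close> over n telescopes to K minus the value at n = 0. The
  correction D_m(0) is nonzero only for m = 0 and m = -1.\<close>

lemma y_rec:
  "q powi m * y (m + 1) + q powi (1 - m) * y (m - 1) + (a + 1 / a) * y m =
   (1 - q powi (2 * m + 1)) * (K - (1 - 1 / a) * D m 0)"
proof -
  have "(\<lambda>n. q powi m * (1 - q powi (2 * m + 3)) * (V n * q ^ n * D (m + 1) (int n))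
     + q powi (1 - m) * (1 - q powi (2 * m - 1)) * (V n * q ^ n * D (m - 1) (int n))
     + (a + 1 / a) * (1 - q powi (2 * m + 1)) * (V n * q ^ n * D m (int n))) sums
     (q powi m * (1 - q powi (2 * m + 3)) * G (m + 1)
      + q powi (1 - m) * (1 - q powi (2 * m - 1)) * G (m - 1) + (a + 1 / a) * (1 - q powi (2 * m + 1)) * G m)"
    by (intro sums_add sums_mult G_sums)
  moreover have "(\<lambda>n. (1 - q powi (2 * m + 1)) * (E m (Suc n) - E m n)) sums ((1 - q powi (2 * m + 1)) * (K - E m 0))"
    by (intro sums_mult telescope_sums E_tendsto)
  ultimately have "q powi m * (1 - q powi (2 * m + 3)) * G (m + 1)
      + q powi (1 - m) * (1 - q powi (2 * m - 1)) * G (m - 1) + (a + 1 / a) * (1 - q powi (2 * m + 1)) * G m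
      = (1 - q powi (2 * m + 1)) * (K - E m 0)"
    unfolding E_diff by (rule sums_unique2)
  moreover have "2 * (m + 1) + 1 = 2 * m + 3" "2 * (m - 1) + 1 = 2 * m - 1" by auto
  ultimately show ?thesis unfolding y_def E_0 by (simp only: mult.assoc)
qed

end

section \<open>Exchange of the summations over n and s\<close>

context nome
begin

lemma nome_power: "N > 0 \<Longrightarrow> nome (q ^ N)"
  using norm_q_pos norm_q_less_1 by unfold_locales (auto simp: norm_power power_less_one_iff)

lemma gauss_summable_power:
  assumes "c \<noteq> 0" "N > 0"
  shows "abs_summable (\<lambda>s. c powi s * q powi (int N * tri s + M * s)) UNIV"
proof -
  interpret Q: nome "q ^ N" by (rule nome_power[OF assms(2)])
  have "c powi s * q powi (int N * tri s + M * s) = (c * q powi M) powi s * (q ^ N) powi tri s" for s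
    by (simp add: power_int_add power_int_mult power_int_mult_distrib)
  then show ?thesis using Q.gauss_summable[of "c * q powi M"] assms by simp
qed

text \<open>Exponents linear in s and binom(s,2) are the form in which
  \<open>gauss_summable_power\<close> applies.\<close>

lemma A_eq:
  assumes "k \<ge> 1"
  shows "A k s = q powi (int (18 * (k - 1) + 12) * tri s + int (12 * (k - 1) + 5) * s) * (1 - q powi (6 * s + 1))"
proof -
  have 1: "(3 * s)\<^sup>2 + 3 * s = 18 * tri s + 12 * s" "6 * s\<^sup>2 - s = 12 * tri s + 5 * s"
    using two_tri[of s] by (simp_all add: power2_eq_square algebra_simps)
  have "((3 * s)\<^sup>2 + 3 * s) * (int k - 1) + (6 * s\<^sup>2 - s) = int (18 * (k - 1) + 12) * tri s + int (12 * (k - 1) + 5) * s"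
    unfolding 1 using assms by (simp add: algebra_simps of_nat_diff)
  then have "q powi (((3 * s)\<^sup>2 + 3 * s) * (int k - 1)) * q powi (6 * s\<^sup>2 - s) =
    q powi (int (18 * (k - 1) + 12) * tri s + int (12 * (k - 1) + 5) * s)"
    by (metis power_int_add q_nonzero)
  then show ?thesis unfolding A_def A0_def mult.assoc[symmetric] by simp
qed

lemma A_summable:
  assumes "k \<ge> 1"
  shows "abs_summable (A k) UNIV"
proof -
  let ?N = "18 * (k - 1) + 12" and ?M = "int (12 * (k - 1) + 5)"
  have s: "abs_summable (\<lambda>s. q powi (int ?N * tri s + M * s)) UNIV" for M
    using gauss_summable_power[of 1 ?N M] by simp
  have "(\<lambda>s. norm (q powi (int ?N * tri s + ?M * s)) + norm q * norm (q powi (int ?N * tri s + (?M + 6) * s))) summable_on UNIV"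
    by (intro summable_on_add summable_on_cmult_right s)
  then show ?thesis
  proof (rule Infinite_Sum.abs_summable_on_comparison_test')
    fix s
    have "A k s = q powi (int ?N * tri s + ?M * s) - q * q powi (int ?N * tri s + (?M + 6) * s)"
    proof -
      have "int ?N * tri s + (?M + 6) * s = (int ?N * tri s + ?M * s) + 6 * s" by (simp only: distrib_right add.assoc)
      then have "q * q powi (int ?N * tri s + (?M + 6) * s) = q powi (int ?N * tri s + ?M * s) * q powi (6 * s + 1)"
        by (simp only: power_int_add q_nonzero simp_thms) simp
      then show ?thesis unfolding A_eq[OF assms] by (simp only: right_diff_distrib mult_1_right)
    qed
    then show "norm (A k s) \<le> norm (q powi (int ?N * tri s + ?M * s)) + norm q * norm (q powi (int ?N * tri s + (?M + 6) * s))"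
      by (metis norm_triangle_ineq4 norm_mult)
  qed
qed

end

context nome_param
begin

lemma G_has_sum: "((\<lambda>n. V n * q ^ n * D m (int n)) has_sum G m) UNIV"
  using norm_summable_imp_has_sum[OF G_summable G_sums] .

text \<open>The double series is dominated by B |q|^n |A_k(s)|, a product of two summable families,
  so it may be summed in either order.\<close>

lemma bailey_sum_sums:
  assumes "k \<ge> 1"
  shows "(\<lambda>n. V n * q ^ n * inner_sum k q n) sums (\<Sum>\<^sub>\<infinity>s. A k s * G (3 * s))"
    and "(\<lambda>s. A k s * G (3 * s)) summable_on UNIV"
proof -
  let ?f = "\<lambda>(n, s). V n * q ^ n * (A k s * D (3 * s) (int n))"
  obtain B where B: "B > 0" "\<And>m n. norm (V n * q ^ n * D m (int n)) \<le> B * norm q ^ n" using VD_bound by blast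
  have "abs_summable (\<lambda>(n, s). of_real (B * norm q ^ n) * A k s) (UNIV \<times> UNIV)"
    using norm_geometric_summable[of B] B(1)
    by (intro abs_summable_on_mult_Times A_summable[OF assms])
       (auto simp: summable_on_UNIV_nonneg_real_iff norm_mult norm_power)
  then have "(\<lambda>x. norm (case x of (n, s) \<Rightarrow> of_real (B * norm q ^ n) * A k s)) summable_on UNIV \<times> UNIV" .
  then have "abs_summable ?f (UNIV \<times> UNIV)"
  proof (rule Infinite_Sum.abs_summable_on_comparison_test')
    fix x :: "nat \<times> int"
    obtain n s where x: "x = (n, s)" by (cases x)
    have "norm (?f x) = norm (V n * q ^ n * D (3 * s) (int n)) * norm (A k s)"
      by (simp add: x norm_mult mult_ac)
    also have "\<dots> \<le> (B * norm q ^ n) * norm (A k s)"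
      by (intro mult_right_mono B) auto
    finally show "norm (?f x) \<le> norm (case x of (n, s) \<Rightarrow> of_real (B * norm q ^ n) * A k s)"
      using B(1) by (simp add: x norm_mult norm_power)
  qed
  then have f: "?f summable_on UNIV \<times> UNIV" by (rule abs_summable_summable)
  have "((\<lambda>n. V n * q ^ n * inner_sum k q n) has_sum infsum ?f (UNIV \<times> UNIV)) UNIV"
    by (rule has_sum_SigmaD[OF has_sum_infsum[OF f]])
       (use has_sum_cmult_right[OF inner_sum_expansion[OF assms]] in auto)
  then have 1: "(\<lambda>n. V n * q ^ n * inner_sum k q n) sums infsum ?f (UNIV \<times> UNIV)"
    by (rule has_sum_imp_sums)
  have "bij_betw prod.swap (UNIV \<times> UNIV :: (int \<times> nat) set) (UNIV \<times> UNIV)"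
    by (rule bij_betwI[where g = prod.swap]) auto
  then have "((\<lambda>x. ?f (prod.swap x)) has_sum infsum ?f (UNIV \<times> UNIV)) (UNIV \<times> UNIV)"
    using has_sum_infsum[OF f] by (subst has_sum_reindex_bij_betw)
  then have 2: "((\<lambda>s. A k s * G (3 * s)) has_sum infsum ?f (UNIV \<times> UNIV)) UNIV"
  proof (rule has_sum_SigmaD)
    fix s
    show "((\<lambda>n. ?f (prod.swap (s, n))) has_sum A k s * G (3 * s)) UNIV"
      using has_sum_cmult_right[OF G_has_sum[of "3 * s"], of "A k s"] by (simp add: mult_ac)
  qed
  show "(\<lambda>n. V n * q ^ n * inner_sum k q n) sums (\<Sum>\<^sub>\<infinity>s. A k s * G (3 * s))"
    using 1 infsumI[OF 2] by simp
  show "(\<lambda>s. A k s * G (3 * s)) summable_on UNIV"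
    using 2 by (rule has_sum_imp_summable)
qed

section \<open>Solution of the recurrence and the triple product\<close>

definition w :: "int \<Rightarrow> complex" where
  "w m = t m * y m"

text \<open>G is even under m -> -1-m. The weight t(m) (1 - q^(2m+1)) is odd, since t(-1-m) = t(m)
  q^(2m+1).\<close>

lemma w_reflect: "w (- 1 - m) = - w m"
proof -
  have "tri (- 1 - m) = tri m + (2 * m + 1)"
    using tri_reflect[of "- 1 - m"] tri_add[of m 2] by (simp add: tri_def add.commute)
  then have t: "t (- 1 - m) = t m * q powi (2 * m + 1)" by (simp add: power_int_add)
  have "q powi (2 * m + 1) * q powi (2 * (- 1 - m) + 1) = 1"
    by (simp flip: power_int_add)
  then show ?thesis
    unfolding w_def y_def t G_reflect by (simp add: algebra_simps)
qed

text \<open>The weight t(m) absorbs the powers q^m and q^(1-m), which leaves constant coefficients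
  with characteristic roots -a and -1/a.\<close>

lemma w_rec:
  "w (m + 1) + w (m - 1) + (a + 1 / a) * w m =
   t m * (1 - q powi (2 * m + 1)) * (K - (1 - 1 / a) * D m 0)"
proof -
  have "t m = t (m - 1) * q powi (m - 1)" using t_add_1[of "m - 1"] by simp
  then have t1: "t (m - 1) = t m * q powi (1 - m)"
    by (simp flip: power_int_add add: mult.assoc)
  have "w (m + 1) + w (m - 1) + (a + 1 / a) * w m =
    t m * (q powi m * y (m + 1) + q powi (1 - m) * y (m - 1) + (a + 1 / a) * y m)"
    unfolding w_def t1 t_add_1 by (simp add: algebra_simps)
  then show ?thesis unfolding y_rec by (simp only: mult.assoc)
qed

text \<open>The decaying solution of the recurrence for \<open>w / K\<close>; see \<open>decaying_solution_zero\<close>.\<close>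

definition W :: "int \<Rightarrow> complex" where
  "W m = partial_theta (- a) m + partial_theta (- 1 / a) m - t (m + 1)"

text \<open>The two partial theta functions belong to the two characteristic roots; subtracting
  t(m+1) adjusts the sum of their inhomogeneities to the required one.\<close>

lemma W_rec: "W (m + 1) + W (m - 1) + (a + 1 / a) * W m = t m * (1 - q powi (2 * m + 1))"
proof -
  have S1: "partial_theta c (m - 1) = t m + c * partial_theta c m" for c using partial_theta_rec[of c "m - 1"] by simp
  have t2: "t (m + 1 + 1) = t m * q powi (2 * m + 1)"
  proof -
    have "q powi m * q powi (m + 1) = q powi (2 * m + 1)" by (simp flip: power_int_add)
    then show ?thesis unfolding t_add_1 mult.assoc by simp
  qed
  show ?thesis
    unfolding W_def S1 partial_theta_rec[of _ m] t2 by (simp add: field_simps)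
qed

text \<open>The difference operator factors as (S + 1/a)(S + a), S being the shift. A solution of
  either first-order factor is a pure geometric sequence, and a Gaussian bound kills every geometric
  sequence, whatever the size of a. The argument is applied to \<open>u\<close>, then to
  \<open>d\<close>.\<close>

lemma decaying_solution_zero:
  fixes d :: "nat \<Rightarrow> complex"
  assumes rec: "\<And>n. d (Suc (Suc n)) + d n + (a + 1 / a) * d (Suc n) = 0"
    and bound: "\<And>n. norm (d n) \<le> C * norm (t (int n))"
  shows "d n = 0"
proof -
  have lim: "(\<lambda>n. norm (c ^ n * t (int n))) \<longlonglongrightarrow> 0" for c
    by (rule summable_LIMSEQ_zero[OF gauss_summable_nat])
  have C: "C \<ge> 0"
    using bound[of 0] order_trans[OF norm_ge_zero[of "d 0"]] by simp
  define u where "u n = d (Suc n) + a * d n" for n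
  have "u (Suc n) = - u n / a" for n
    using rec[of n] by (simp add: u_def field_simps) (metis add_eq_0_iff2 add.commute add.assoc)
  then have u: "a ^ n * u n = (- 1) ^ n * u 0" for n
    by (induction n) (simp_all del: power_Suc add: power_Suc2)
  have "(\<lambda>n. norm (u 0)) \<longlonglongrightarrow> 0"
  proof (rule tendsto_sandwich[of "\<lambda>_. 0" _ _ "\<lambda>n. C * (1 + norm a) * norm (a ^ n * t (int n))"])
    have "norm (u 0) \<le> C * (1 + norm a) * norm (a ^ n * t (int n))" for n
    proof -
      have "t (int (Suc n)) = t (int n) * q powi int n" using t_add_1[of "int n"] by (simp add: add.commute)
      then have t: "norm (t (int (Suc n))) \<le> norm (t (int n))"
        using norm_powi_le_1[of "int n"] by (simp add: norm_mult mult_left_le)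
      have "norm (u n) \<le> norm (d (Suc n)) + norm a * norm (d n)"
        unfolding u_def by (metis norm_mult norm_triangle_ineq)
      also have "\<dots> \<le> C * norm (t (int n)) + norm a * (C * norm (t (int n)))"
        by (intro add_mono mult_left_mono bound order_trans[OF bound mult_left_mono[OF t C]]) auto
      finally have "norm (u n) \<le> C * (1 + norm a) * norm (t (int n))" by (simp add: algebra_simps)
      then have "norm (a ^ n) * norm (u n) \<le> norm (a ^ n) * (C * (1 + norm a) * norm (t (int n)))"
        by (rule mult_left_mono) auto
      moreover have "norm (a ^ n) * norm (u n) = norm (u 0)"
        using arg_cong[OF u[of n], of norm] by (simp add: norm_mult norm_power)
      ultimately have "norm (u 0) \<le> norm (a ^ n) * (C * (1 + norm a) * norm (t (int n)))" by simp
      then show ?thesis by (simp only: norm_mult mult_ac)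
    qed
    then show "\<forall>\<^sub>F n in sequentially. norm (u 0) \<le> C * (1 + norm a) * norm (a ^ n * t (int n))" by simp
    show "(\<lambda>n. C * (1 + norm a) * norm (a ^ n * t (int n))) \<longlonglongrightarrow> 0"
      using tendsto_mult_left[OF lim[of a], of "C * (1 + norm a)"] by simp
  qed simp_all
  then have "u 0 = 0" by (simp add: LIMSEQ_const_iff)
  then have "a ^ n * u n = 0" for n using u[of n] by simp
  then have "d (Suc n) = - a * d n" for n by (simp add: u_def add_eq_0_iff2)
  then have d: "d n = (- a) ^ n * d 0" for n by (induction n) simp_all
  have "(\<lambda>n. norm (d 0)) \<longlonglongrightarrow> 0"
  proof (rule tendsto_sandwich[of "\<lambda>_. 0" _ _ "\<lambda>n. C * norm ((1 / a) ^ n * t (int n))"])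
    have "norm (d 0) \<le> C * norm ((1 / a) ^ n * t (int n))" for n
    proof -
      have "norm (d 0) = norm ((1 / a) ^ n) * norm (d n)"
        using d[of n] by (simp add: norm_mult norm_power norm_divide power_divide)
      also have "\<dots> \<le> norm ((1 / a) ^ n) * (C * norm (t (int n)))"
        by (intro mult_left_mono bound) auto
      finally show ?thesis by (simp add: norm_mult mult_ac)
    qed
    then show "\<forall>\<^sub>F n in sequentially. norm (d 0) \<le> C * norm ((1 / a) ^ n * t (int n))" by simp
    show "(\<lambda>n. C * norm ((1 / a) ^ n * t (int n))) \<longlonglongrightarrow> 0"
      using tendsto_mult_left[OF lim[of "1 / a"], of C] by simp
  qed simp_all
  then have "d 0 = 0" by (simp add: LIMSEQ_const_iff)
  then show ?thesis using d[of n] by simp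
qed

text \<open>Both sides obey the same recurrence at indices m >= 1 and a Gaussian bound:
  \<open>w\<close> because G is bounded, \<open>W\<close> by
  \<open>norm_partial_theta_le\<close>.\<close>

lemma w_eq_W_nat: "w (int n) = K * W (int n)"
proof -
  obtain B where B: "B > 0" "\<And>m. norm (G m) \<le> B" using G_bound by blast
  define C1 C2 where "C1 = (\<Sum>j. norm ((- a) ^ j * t (int j)))" and "C2 = (\<Sum>j. norm ((- 1 / a) ^ j * t (int j)))"
  define d where "d n = w (int n) - K * W (int n)" for n
  have "d n = 0"
  proof (rule decaying_solution_zero)
    fix n
    \<comment> \<open>The recurrence is centred at n + 1 >= 1, where the correction D_m(0)
      vanishes.\<close>
    define m where "m = int n + 1"
    have e: "int (Suc n) = m" "int (Suc (Suc n)) = m + 1" "int n = m - 1" by (simp_all add: m_def)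
    have D: "D m 0 = 0" by (rule D_eq_0) (simp add: m_def)
    have "d (Suc (Suc n)) + d n + (a + 1 / a) * d (Suc n) =
      (w (m + 1) + w (m - 1) + (a + 1 / a) * w m) - K * (W (m + 1) + W (m - 1) + (a + 1 / a) * W m)"
      unfolding d_def e by (simp add: algebra_simps)
    also have "\<dots> = 0" unfolding w_rec W_rec D by simp
    finally show "d (Suc (Suc n)) + d n + (a + 1 / a) * d (Suc n) = 0" .
  next
    fix n
    have tt: "norm (t (int n + 1)) \<le> norm (t (int n))"
      using norm_powi_le_1[of "int n"] by (simp add: t_add_1 norm_mult mult_left_le)
    have C: "C1 \<ge> 0" "C2 \<ge> 0" unfolding C1_def C2_def by (intro suminf_nonneg gauss_summable_nat; simp)+
    have "norm (y (int n)) \<le> 2 * B"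
    proof -
      have "norm (1 - q powi (2 * int n + 1)) \<le> 1 + norm (q powi (2 * int n + 1))"
        by (metis norm_one norm_triangle_ineq4)
      also have "\<dots> \<le> 2" using norm_powi_le_1[of "2 * int n + 1"] by simp
      finally show ?thesis
        unfolding y_def norm_mult using B by (intro mult_mono) auto
    qed
    then have w: "norm (w (int n)) \<le> 2 * B * norm (t (int n))"
      by (simp add: w_def norm_mult mult.commute mult_left_mono)
    have partial_theta: "norm (partial_theta c (int n)) \<le> norm (t (int n)) * (\<Sum>j. norm (c ^ j * t (int j)))" for c
    proof -
      have "norm (partial_theta c (int n)) \<le> norm (t (int n + 1)) * (\<Sum>j. norm (c ^ j * t (int j)))"
        by (rule norm_partial_theta_le) simp
      also have "\<dots> \<le> norm (t (int n)) * (\<Sum>j. norm (c ^ j * t (int j)))"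
        by (intro mult_right_mono tt suminf_nonneg gauss_summable_nat) auto
      finally show ?thesis .
    qed
    have "norm (W (int n)) \<le> norm (partial_theta (- a) (int n)) + norm (partial_theta (- 1 / a) (int n)) + norm (t (int n + 1))"
      unfolding W_def by (rule order_trans[OF norm_triangle_ineq4 add_right_mono[OF norm_triangle_ineq]])
    also have "\<dots> \<le> (C1 + C2 + 1) * norm (t (int n))"
      using partial_theta[of "- a"] partial_theta[of "- 1 / a"] tt unfolding C1_def[symmetric] C2_def[symmetric] by (simp add: algebra_simps)
    finally have "norm (K * W (int n)) \<le> norm K * ((C1 + C2 + 1) * norm (t (int n)))"
      unfolding norm_mult by (rule mult_left_mono) auto
    then show "norm (d n) \<le> (2 * B + norm K * (C1 + C2 + 1)) * norm (t (int n))"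
      using w norm_triangle_ineq4[of "w (int n)" "K * W (int n)"] unfolding d_def
      by (simp add: algebra_simps)
  qed
  then show ?thesis by (simp add: d_def)
qed

text \<open>
  Jacobi's triple product: the recurrence for \<^term>\<open>w\<close> has an inhomogeneous term at 0 that the
  one for \<^term>\<open>W\<close> lacks, and comparing both determines the constant \<^term>\<open>K\<close>.
\<close>

theorem jacobi_triple_product_K: "K * theta a = 1"
proof -
  have D0: "D 0 0 = 1 / (1 - q)"
    using inv_qfact_rec[of 0] power_q_neq_1[of 1] by (simp add: D_def field_simps)
  have "w (- 1) = - w 0" using w_reflect[of 0] by simp
  then have "w 1 - w 0 + (a + 1 / a) * w 0 = (1 - q) * (K - (1 - 1 / a) / (1 - q))"
    using w_rec[of 0] by (simp add: D0)
  also have "\<dots> = (1 - q) * K - (1 - 1 / a)"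
  proof -
    have "1 - q \<noteq> 0" using power_q_neq_1[of 1] by simp
    then show ?thesis unfolding right_diff_distrib[of "1 - q" K] by (simp del: right_diff_distrib)
  qed
  finally have "w 1 - w 0 + (a + 1 / a) * w 0 = (1 - q) * K - (1 - 1 / a)" .
  then have 1: "K * W 1 - K * W 0 + (a + 1 / a) * (K * W 0) = (1 - q) * K - (1 - 1 / a)"
    using w_eq_W_nat[of 0] w_eq_W_nat[of 1] by simp
  have 2: "W 1 + W (- 1) + (a + 1 / a) * W 0 = 1 - q"
    using W_rec[of 0] by simp
  \<comment> \<open>The recurrences of \<open>K * W\<close> and \<open>w\<close> at 0 are
    subtracted. At index -1 the latter contributes - w(0) = - K W(0) by oddness, so only this
    combination is left.\<close>
  have "K * (W 0 + W (- 1)) = K * (W 1 + W (- 1) + (a + 1 / a) * W 0) - (K * W 1 - K * W 0 + (a + 1 / a) * (K * W 0))"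
    by (simp add: algebra_simps)
  then have "K * (W 0 + W (- 1)) = 1 - 1 / a"
    unfolding 1 2 by (simp add: algebra_simps)
  moreover have "W 0 + W (- 1) = (1 - 1 / a) * theta a"
  proof -
    have 1: "partial_theta (- a) (- 1) = 1 - a * partial_theta (- a) 0" "partial_theta (- 1 / a) (- 1) = 1 - partial_theta (- 1 / a) 0 / a"
      using partial_theta_rec[of "- a" "- 1"] partial_theta_rec[of "- 1 / a" "- 1"] by simp_all
    show ?thesis unfolding theta_eq_partial_theta[OF a_nonzero] W_def 1 by (simp add: field_simps)
  qed
  moreover have "1 - 1 / a \<noteq> 0" using q_a_nonzero[of 0] by simp
  ultimately show ?thesis by (simp add: mult.left_commute)
qed

lemma K_nonzero: "K \<noteq> 0"
  using jacobi_triple_product_K by auto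

theorem jacobi_triple_product: "theta a = qpochs_inf [q, a, q / a] q"
  using jacobi_triple_product_K K_nonzero by (simp add: K_def field_simps)

text \<open>What remains of \<open>W\<close> once a full theta series is removed. Because
  binom(1-n,2) = binom(n,2), the bracket is odd under m -> -1-m.\<close>

definition R :: "int \<Rightarrow> complex" where
  "R m = (\<Sum>j. (- a) ^ j * (t (m + 1 + int j) - t (m + 1 - int j)))"

lemma shifted_summable: "abs_summable (\<lambda>j. (- a) powi j * t (m + 1 - j)) UNIV"
proof -
  have eq: "(- a) powi j * t (m + 1 - j) = t (- m) * ((- a * q powi (- m)) powi j * t j)" for j
  proof -
    have "tri (m + 1 - j) = tri (- m + j)" using tri_reflect[of "- m + j"] by (simp add: algebra_simps)
    then show ?thesis
      by (simp only: t_add power_int_mult_distrib power_int_mult) (simp only: mult_ac)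
  qed
  have "abs_summable (\<lambda>j. (- a * q powi (- m)) powi j * t j) UNIV" by (rule gauss_summable) simp
  then show ?thesis
    unfolding eq norm_mult[of "t (- m)"] by (rule summable_on_cmult_right)
qed

lemma R_summable: "summable (\<lambda>j. (- a) ^ j * (t (m + 1 + int j) - t (m + 1 - int j)))"
  unfolding right_diff_distrib
  using summable_norm_cancel[OF partial_theta_summable[of "- a" "m + 1"]] infsum_int_split(2)[OF shifted_summable[of m]]
  by (intro summable_diff) simp_all

lemma R_reflect: "R (- 1 - m) = - R m"
proof -
  have "(- a) ^ j * (t (- 1 - m + 1 + int j) - t (- 1 - m + 1 - int j)) =
    - ((- a) ^ j * (t (m + 1 + int j) - t (m + 1 - int j)))" for j
    using tri_reflect[of "- m + int j"] tri_reflect[of "- m - int j"] by (simp add: algebra_simps)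
  then show ?thesis unfolding R_def by (simp add: suminf_minus[OF R_summable])
qed

text \<open>The bilateral series of (-a)^j t(m+1-j) is (-a)^m theta(a) by
  \<open>theta_shift\<close>. Its negative half is the partial theta function at -1/a less t(m+1),
  its other half is the subtracted part of \<open>R\<close>.\<close>

lemma W_eq_theta: "W m = (- a) powi m * theta a + R m"
proof -
  note split = infsum_int_split[OF shifted_summable[of m]]
  have s1: "summable (\<lambda>j. (- a) ^ j * t (m + 1 - int j))" using split(2) by simp
  have s2: "summable (\<lambda>j. (- a) ^ j * t (m + 1 + int j))" by (rule summable_norm_cancel[OF partial_theta_summable])
  have "(- a) powi m * theta a = (\<Sum>j. (- a) ^ j * t (m + 1 - int j)) + (\<Sum>j. (- 1 / a) ^ Suc j * t (m + 1 + 1 + int j))"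
    using split(1) unfolding theta_shift[OF a_nonzero] powi_neg_Suc[OF a_nonzero] by (simp add: algebra_simps)
  also have "(\<Sum>j. (- 1 / a) ^ Suc j * t (m + 1 + 1 + int j)) = (- 1 / a) * partial_theta (- 1 / a) (m + 1)"
    unfolding partial_theta_def power_Suc mult.assoc by (rule suminf_mult[OF summable_norm_cancel[OF partial_theta_summable]])
  also have "\<dots> = partial_theta (- 1 / a) m - t (m + 1)" using partial_theta_rec[of "- 1 / a" m] by simp
  finally have "(- a) powi m * theta a = (\<Sum>j. (- a) ^ j * t (m + 1 - int j)) + (partial_theta (- 1 / a) m - t (m + 1))" .
  moreover have "R m = partial_theta (- a) m - (\<Sum>j. (- a) ^ j * t (m + 1 - int j))"
    unfolding R_def partial_theta_def right_diff_distrib by (rule suminf_diff[OF s2 s1, symmetric])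
  ultimately show ?thesis by (simp add: W_def)
qed

text \<open>The extension of (-a)^m from m >= 0 that is odd under m -> -1-m, forced by the oddness
  of \<open>w\<close> and \<open>R\<close>.\<close>

definition e :: "int \<Rightarrow> complex" where
  "e m = (if m \<ge> 0 then (- a) powi m else - ((- a) powi (- 1 - m)))"

lemma w_decomposition: "w m = e m + K * R m"
proof -
  have nonneg: "w m = (- a) powi m + K * R m" if "m \<ge> 0" for m
  proof -
    have "w m = K * W m" using w_eq_W_nat[of "nat m"] that by simp
    also have "\<dots> = (- a) powi m * (K * theta a) + K * R m"
      unfolding W_eq_theta by (simp add: algebra_simps)
    finally show ?thesis by (simp add: jacobi_triple_product_K)
  qed
  show ?thesis
  proof (cases "m \<ge> 0")
    case True
    then show ?thesis using nonneg[of m] by (simp add: e_def)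
  next
    case False
    then show ?thesis
      using nonneg[of "- 1 - m"] w_reflect[of m] R_reflect[of m]
      by (simp add: e_def) (metis minus_diff_eq minus_minus)
  qed
qed

text \<open>Here 3 tri s + 2 s = s(3s+1)/2. The factor 1 - q^(6s+1) of A passes into
  \<open>y\<close>, and 6k - 5 = 2\<kappa> - 3.\<close>

lemma A_mult_G_eq:
  assumes "k \<ge> 1"
  shows "A k s * G (3 * s) = q powi ((6 * int k - 5) * (3 * tri s + 2 * s)) * w (3 * s)"
proof -
  have "tri (3 * s) = 9 * tri s + 3 * s"
  proof -
    have "2 * tri (3 * s) = 2 * (9 * tri s + 3 * s)"
      using two_tri[of s] two_tri[of "3 * s"] by (simp add: algebra_simps)
    then show ?thesis by simp
  qed
  then have "(6 * int k - 5) * (3 * tri s + 2 * s) + tri (3 * s) = int (18 * (k - 1) + 12) * tri s + int (12 * (k - 1) + 5) * s"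
    using assms by (simp add: of_nat_diff algebra_simps)
  then have "q powi ((6 * int k - 5) * (3 * tri s + 2 * s)) * t (3 * s) = q powi (int (18 * (k - 1) + 12) * tri s + int (12 * (k - 1) + 5) * s)"
    by (metis power_int_add q_nonzero)
  then show ?thesis
    unfolding A_eq[OF assms] w_def y_def by (simp add: mult.assoc[symmetric])
qed

end

section \<open>The quintuple product identity\<close>

lemma infsum_mult_Times:
  fixes f :: "'a \<Rightarrow> complex" and g :: "'b \<Rightarrow> complex"
  assumes "abs_summable f B" "abs_summable g C"
  shows "((\<lambda>(x, y). f x * g y) has_sum infsum f B * infsum g C) (B \<times> C)"
proof -
  have s: "(\<lambda>(x, y). f x * g y) summable_on B \<times> C"
    using abs_summable_on_mult_Times[OF assms] by (rule abs_summable_summable)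
  have "infsum (\<lambda>(x, y). f x * g y) (B \<times> C) = infsum (\<lambda>x. infsum (\<lambda>y. f x * g y) C) B"
    by (rule infsum_Sigma'_banach[OF s, symmetric])
  also have "\<dots> = infsum f B * infsum g C"
    by (simp add: infsum_cmult_right' infsum_cmult_left')
  finally show ?thesis using has_sum_infsum[OF s] by simp
qed

lemma qpoch_inf_trisect:
  assumes "norm q < 1"
  shows "qpoch_inf x q = qpoch_inf x (q ^ 3) * qpoch_inf (x * q) (q ^ 3) * qpoch_inf (x * q\<^sup>2) (q ^ 3)"
proof -
  have lim: "(\<lambda>n. \<Prod>j<n. 1 - z * r ^ j) \<longlonglongrightarrow> qpoch_inf z r" if "norm r < 1" for z r
    using convergent_prod_LIMSEQ[OF convergent_prod_qpoch[OF that, of z]]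
    unfolding qpoch_inf_def by (simp add: LIMSEQ_lessThan_iff_atMost)
  have "norm (q ^ 3) < 1" using assms by (simp add: norm_power power_less_one_iff)
  then have "(\<lambda>n. (\<Prod>j<n. 1 - x * (q ^ 3) ^ j) * (\<Prod>j<n. 1 - x * q * (q ^ 3) ^ j) * (\<Prod>j<n. 1 - x * q\<^sup>2 * (q ^ 3) ^ j))
    \<longlonglongrightarrow> qpoch_inf x (q ^ 3) * qpoch_inf (x * q) (q ^ 3) * qpoch_inf (x * q\<^sup>2) (q ^ 3)"
    by (intro tendsto_mult lim)
  moreover have "(\<Prod>j<n. 1 - x * (q ^ 3) ^ j) * (\<Prod>j<n. 1 - x * q * (q ^ 3) ^ j) * (\<Prod>j<n. 1 - x * q\<^sup>2 * (q ^ 3) ^ j)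
    = (\<Prod>j<3 * n. 1 - x * q ^ j)" for n
  proof (induction n)
    case (Suc n)
    have "3 * Suc n = Suc (Suc (Suc (3 * n)))" by simp
    then have "(\<Prod>j<3 * Suc n. 1 - x * q ^ j) = (\<Prod>j<3 * n. 1 - x * q ^ j)
      * ((1 - x * q ^ (3 * n)) * (1 - x * q * q ^ (3 * n)) * (1 - x * q\<^sup>2 * q ^ (3 * n)))"
      by (simp only: prod.lessThan_Suc) (simp add: power2_eq_square mult_ac)
    then show ?case unfolding Suc.IH[symmetric] by (simp add: power_mult[symmetric] mult_ac)
  qed simp
  moreover have "(\<lambda>n. \<Prod>j<3 * n. 1 - x * q ^ j) \<longlonglongrightarrow> qpoch_inf x q"
    by (rule filterlim_compose[OF lim[OF assms]]) (simp add: filterlim_subseq strict_mono_def)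
  ultimately show ?thesis by (metis (no_types, lifting) LIMSEQ_unique ext)
qed

context nome
begin

lemma theta_eq_prod:
  assumes "z \<noteq> 0" "\<And>m. z \<noteq> q powi m"
  shows "theta z = qpochs_inf [q, z, q / z] q"
proof -
  interpret nome_param q z using assms by unfold_locales auto
  show ?thesis by (rule jacobi_triple_product)
qed

lemma powi_q_inj: "q powi m = q powi n \<longleftrightarrow> m = n"
  using powi_q_neq_1[of "m - n"] by (auto simp: power_int_diff)

lemma powi_of_power: "(q ^ N) powi m = q powi (int N * m)"
  by (simp add: power_int_mult)

text \<open>Euler's pentagonal number theorem in q^2, since 6 tri l + 4 l = l(3l+1): the triple
  product with base q^6 gives the three residue classes of (q^2;q^2).\<close>

lemma theta_pentagonal:
  "(\<Sum>\<^sub>\<infinity>l. (-1) powi l * q powi (6 * tri l + 4 * l)) = qpoch_inf (q\<^sup>2) (q\<^sup>2)"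
proof -
  interpret Q: nome "q ^ 6" by (rule nome_power) simp
  have "(- 1) powi l * q powi (6 * tri l + 4 * l) = (- (q ^ 4)) powi l * (q ^ 6) powi tri l" for l
  proof -
    have "(- (q ^ 4)) powi l = (- 1) powi l * q powi (4 * l)"
      using power_int_mult_distrib[of "- 1" "q ^ 4" l] powi_of_power[of 4 l] by simp
    moreover have "(q ^ 6) powi tri l = q powi (6 * tri l)"
      using powi_of_power[of 6 "tri l"] by simp
    ultimately show ?thesis by (simp add: power_int_add)
  qed
  then have "(\<Sum>\<^sub>\<infinity>l. (-1) powi l * q powi (6 * tri l + 4 * l)) = Q.theta (q ^ 4)"
    by (simp add: Q.theta_def)
  also have "\<dots> = qpochs_inf [q ^ 6, q ^ 4, q ^ 6 / q ^ 4] (q ^ 6)"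
  proof (rule Q.theta_eq_prod)
    fix m show "q ^ 4 \<noteq> (q ^ 6) powi m"
      using powi_q_inj[of 4 "6 * m"] powi_of_power[of 6 m] by simp presburger
  qed simp
  also have "\<dots> = qpoch_inf (q\<^sup>2) ((q\<^sup>2) ^ 3) * qpoch_inf (q\<^sup>2 * q\<^sup>2) ((q\<^sup>2) ^ 3) * qpoch_inf (q\<^sup>2 * (q\<^sup>2)\<^sup>2) ((q\<^sup>2) ^ 3)"
  proof -
    have "q ^ 6 / q ^ 4 = q\<^sup>2" by (simp add: field_simps flip: power_add)
    moreover have "(q\<^sup>2) ^ 3 = q ^ 6" "q\<^sup>2 * q\<^sup>2 = q ^ 4" "q\<^sup>2 * (q\<^sup>2)\<^sup>2 = q ^ 6"
      by (simp_all flip: power_mult power_add)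
    ultimately show ?thesis by (simp add: qpochs_inf_def mult_ac)
  qed
  also have "\<dots> = qpoch_inf (q\<^sup>2) (q\<^sup>2)"
    using qpoch_inf_trisect[of "q\<^sup>2" "q\<^sup>2"] norm_q_less_1 by (simp add: norm_power power_less_one_iff)
  finally show ?thesis .
qed

text \<open>The general term of theta(z) times the theta function of base q^2 at q z^2. The power of
  z is j + 2l, so j = N - 2l collects the coefficient of z^N.\<close>

definition theta_mult_term :: "complex \<Rightarrow> int \<Rightarrow> int \<Rightarrow> complex" where
  "theta_mult_term z j l = ((- z) powi j * t j) * ((- (q * z\<^sup>2)) powi l * (q\<^sup>2) powi tri l)"

lemma theta_mult_term_eq:
  assumes "z \<noteq> 0"
  shows "theta_mult_term z j l = (- 1) powi (j + l) * z powi (j + 2 * l) * q powi (tri j + l\<^sup>2)"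
proof -
  have "(- z) powi j = (- 1) powi j * z powi j"
    using power_int_mult_distrib[of "- 1" z j] by simp
  moreover have "(- (q * z\<^sup>2)) powi l = (- 1) powi l * (q powi l * z powi (2 * l))"
    using power_int_mult_distrib[of "- 1" "q * z\<^sup>2" l] power_int_mult[of z 2 l]
    by (simp add: power_int_mult_distrib)
  moreover have "(q\<^sup>2) powi tri l * q powi l = q powi (l\<^sup>2)"
  proof -
    have "l\<^sup>2 = 2 * tri l + l" unfolding two_tri by (simp add: power2_eq_square algebra_simps)
    then show ?thesis using powi_of_power[of 2 "tri l"] by (simp add: power_int_add)
  qed
  ultimately show ?thesis
    using assms by (simp add: theta_mult_term_def power_int_add mult_ac)
qed

lemma theta_mult_has_sum:
  assumes "z \<noteq> 0"
  defines "\<theta> \<equiv> theta z * nome.theta (q\<^sup>2) (q * z\<^sup>2)"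
  shows "((\<lambda>N. \<Sum>\<^sub>\<infinity>l. theta_mult_term z (N - 2 * l) l) has_sum \<theta>) UNIV"
proof -
  interpret Q: nome "q\<^sup>2" by (rule nome_power) simp
  have s1: "abs_summable (\<lambda>j. (- z) powi j * t j) UNIV"
    using assms by (intro gauss_summable) auto
  have s2: "abs_summable (\<lambda>l. (- (q * z\<^sup>2)) powi l * (q\<^sup>2) powi tri l) UNIV"
    using assms by (intro Q.gauss_summable) auto
  have "((\<lambda>(j, l). theta_mult_term z j l) has_sum \<theta>) (UNIV \<times> UNIV)"
    using infsum_mult_Times[OF s1 s2] by (simp add: theta_mult_term_def \<theta>_def theta_def Q.theta_def)
  moreover have "bij_betw (\<lambda>(N, l). (N - 2 * l, l)) (UNIV \<times> UNIV) (UNIV \<times> (UNIV :: int set))"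
    by (rule bij_betwI[where g = "\<lambda>(j, l). (j + 2 * l, l)"]) auto
  ultimately have h: "((\<lambda>x. case (case x of (N, l) \<Rightarrow> (N - 2 * l, l)) of (j, l) \<Rightarrow> theta_mult_term z j l) has_sum \<theta>) (UNIV \<times> UNIV)"
    by (subst has_sum_reindex_bij_betw)
  then have h: "((\<lambda>(N, l). theta_mult_term z (N - 2 * l) l) has_sum \<theta>) (UNIV \<times> UNIV)"
    by (simp add: case_prod_unfold)
  show ?thesis
  proof (rule has_sum_SigmaD[OF h])
    fix N :: int
    have "(\<lambda>l. theta_mult_term z (N - 2 * l) l) summable_on UNIV"
      using summable_on_SigmaD1[OF has_sum_imp_summable[OF h], of N] by simp
    then show "((\<lambda>l. case (N, l) of (N, l) \<Rightarrow> theta_mult_term z (N - 2 * l) l) has_sum (\<Sum>\<^sub>\<infinity>l. theta_mult_term z (N - 2 * l) l)) UNIV"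
      by (simp add: has_sum_infsum)
  qed
qed

text \<open>For fixed N the exponent of q is 3 l^2 - (2N-1) l plus a constant, centred at (2N-1)/6.
  For N = 3s the centre is s - 1/6, and the shift by s leaves l(3l+1).\<close>

lemma theta_mult_slice_0:
  assumes "z \<noteq> 0"
  shows "(\<Sum>\<^sub>\<infinity>l. theta_mult_term z (3 * s - 2 * l) l) = qpoch_inf (q\<^sup>2) (q\<^sup>2) * (z powi (3 * s) * q powi (3 * tri s + s))"
proof -
  have "theta_mult_term z (3 * s - 2 * (l + s)) (l + s) = (-1) powi l * q powi (6 * tri l + 4 * l) * (z powi (3 * s) * q powi (3 * tri s + s))" for l
  proof -
    have "tri (3 * s - 2 * (l + s)) + (l + s)\<^sup>2 = (6 * tri l + 4 * l) + (3 * tri s + s)"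
    proof -
      have "2 * (tri (3 * s - 2 * (l + s)) + (l + s)\<^sup>2) = 2 * ((6 * tri l + 4 * l) + (3 * tri s + s))"
        using two_tri[of "3 * s - 2 * (l + s)"] two_tri[of l] two_tri[of s]
        by (simp add: power2_eq_square algebra_simps)
      then show ?thesis by simp
    qed
    moreover have "(- 1 :: complex) powi (3 * s - 2 * (l + s) + (l + s)) = (- 1) powi l"
      using neg_one_powi_even[of "2 * s - 2 * l" l] by (simp add: algebra_simps)
    moreover have "3 * s - 2 * (l + s) + 2 * (l + s) = 3 * s" by simp
    ultimately show ?thesis unfolding theta_mult_term_eq[OF assms] by (simp only: power_int_add q_nonzero simp_thms mult_ac)
  qed
  then show ?thesis
    using infsum_int_shift[of "\<lambda>l. theta_mult_term z (3 * s - 2 * l) l" s] theta_pentagonal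
    by (simp only: infsum_cmult_left')
qed

text \<open>Now the centre is s + 1/6, so the reflection l -> s - l produces the same pentagonal
  series; the parity of the sign changes.\<close>

lemma theta_mult_slice_1:
  assumes "z \<noteq> 0"
  shows "(\<Sum>\<^sub>\<infinity>l. theta_mult_term z (3 * s + 1 - 2 * l) l) = - (qpoch_inf (q\<^sup>2) (q\<^sup>2) * (z powi (3 * s + 1) * q powi (3 * tri s + 2 * s)))"
proof -
  have "theta_mult_term z (3 * s + 1 - 2 * (s - l)) (s - l) = (-1) powi l * q powi (6 * tri l + 4 * l) * (- (z powi (3 * s + 1) * q powi (3 * tri s + 2 * s)))" for l
  proof -
    have "tri (3 * s + 1 - 2 * (s - l)) + (s - l)\<^sup>2 = (6 * tri l + 4 * l) + (3 * tri s + 2 * s)"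
    proof -
      have "2 * (tri (3 * s + 1 - 2 * (s - l)) + (s - l)\<^sup>2) = 2 * ((6 * tri l + 4 * l) + (3 * tri s + 2 * s))"
        using two_tri[of "3 * s + 1 - 2 * (s - l)"] two_tri[of l] two_tri[of s]
        by (simp add: power2_eq_square algebra_simps)
      then show ?thesis by simp
    qed
    moreover have "(- 1 :: complex) powi (3 * s + 1 - 2 * (s - l) + (s - l)) = - ((- 1) powi l)"
      using neg_one_powi_even[of "2 * s" "l + 1"] by (simp add: algebra_simps power_int_add)
    moreover have "3 * s + 1 - 2 * (s - l) + 2 * (s - l) = 3 * s + 1" by simp
    ultimately show ?thesis unfolding theta_mult_term_eq[OF assms]
      by (simp only: power_int_add q_nonzero simp_thms mult_ac mult_minus_left mult_minus_right)
  qed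
  then show ?thesis
    using infsum_int_reflect[of "\<lambda>l. theta_mult_term z (3 * s + 1 - 2 * l) l" s] theta_pentagonal
    by (simp only: infsum_cmult_left' mult_minus_right infsum_uminus)
qed

text \<open>Now the centre is s + 1/2: the reflection l -> 2s+1-l keeps the exponent and flips the
  sign, so the slice equals its own negative.\<close>

lemma theta_mult_slice_2:
  assumes "z \<noteq> 0"
  shows "(\<Sum>\<^sub>\<infinity>l. theta_mult_term z (3 * s + 2 - 2 * l) l) = 0"
proof -
  have "theta_mult_term z (3 * s + 2 - 2 * (2 * s + 1 - l)) (2 * s + 1 - l) = - theta_mult_term z (3 * s + 2 - 2 * l) l" for l
  proof -
    have "tri (3 * s + 2 - 2 * (2 * s + 1 - l)) + (2 * s + 1 - l)\<^sup>2 = tri (3 * s + 2 - 2 * l) + l\<^sup>2"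
    proof -
      have "2 * (tri (3 * s + 2 - 2 * (2 * s + 1 - l)) + (2 * s + 1 - l)\<^sup>2) = 2 * (tri (3 * s + 2 - 2 * l) + l\<^sup>2)"
        unfolding distrib_left two_tri by (simp add: power2_eq_square algebra_simps)
      then show ?thesis by simp
    qed
    moreover have "(- 1 :: complex) powi (3 * s + 2 - 2 * (2 * s + 1 - l) + (2 * s + 1 - l)) = - ((- 1) powi (3 * s + 2 - 2 * l + l))"
    proof -
      have "3 * s + 2 - 2 * (2 * s + 1 - l) + (2 * s + 1 - l) = (2 * l - 2 * s - 2) + ((3 * s + 2 - 2 * l + l) + 1)" by simp
      moreover have "even (2 * l - 2 * s - 2)" by simp
      ultimately show ?thesis by (simp only: neg_one_powi_even neg_one_powi_Suc)
    qed
    moreover have "3 * s + 2 - 2 * (2 * s + 1 - l) + 2 * (2 * s + 1 - l) = 3 * s + 2 - 2 * l + 2 * l" by simp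
    ultimately show ?thesis unfolding theta_mult_term_eq[OF assms] by (simp only: mult_minus_left)
  qed
  then have "(\<Sum>\<^sub>\<infinity>l. theta_mult_term z (3 * s + 2 - 2 * l) l) = - (\<Sum>\<^sub>\<infinity>l. theta_mult_term z (3 * s + 2 - 2 * l) l)"
    using infsum_int_reflect[of "\<lambda>l. theta_mult_term z (3 * s + 2 - 2 * l) l" "2 * s + 1"] by (simp add: infsum_uminus)
  then show ?thesis by simp
qed

text \<open>
  The quintuple product identity, from the product of two theta functions: the coefficient of
  \<open>z\<^sup>N\<close> vanishes for \<open>N mod 3 = 2\<close> and is a multiple of the pentagonal number series otherwise.
\<close>

theorem quintuple_product:
  assumes z: "z \<noteq> 0" "\<And>m. z \<noteq> q powi m" "\<And>m. z\<^sup>2 \<noteq> q powi m"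
  shows "(\<Sum>\<^sub>\<infinity>s. q powi (3 * tri s + 2 * s) * (z powi (- 3 * s) - z powi (3 * s + 1))) =
    qpochs_inf [q, z, q / z] q * qpochs_inf [q * z\<^sup>2, q / z\<^sup>2] (q\<^sup>2)"
proof -
  interpret Q: nome "q\<^sup>2" by (rule nome_power) simp
  let ?c = "qpoch_inf (q\<^sup>2) (q\<^sup>2)" and ?g = "\<lambda>N. \<Sum>\<^sub>\<infinity>l. theta_mult_term z (N - 2 * l) l"
  let ?\<theta> = "theta z * nome.theta (q\<^sup>2) (q * z\<^sup>2)"
  have c: "?c \<noteq> 0" using Q.qpoch_inf_q_nonzero[of 0] by simp
  have g: "?g summable_on B" for B
    using has_sum_imp_summable[OF theta_mult_has_sum[OF z(1)]] summable_on_subset_banach by blast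
  \<comment> \<open>The slice N = 3s is traversed with s negated so that both slices carry the same
    power of q.\<close>
  have z3: "z powi (- 3 * s) * q powi (3 * tri s + 2 * s) = z powi (3 * (- s)) * q powi (3 * tri (- s) + (- s))" for s
    by (simp add: tri_uminus add.commute)
  have i0: "inj (\<lambda>s :: int. 3 * s)" and i1: "inj (\<lambda>s :: int. 3 * s + 1)" by (auto intro: injI)
  have "?\<theta> = infsum ?g UNIV" using infsumI[OF theta_mult_has_sum[OF z(1)]] by simp
  also have "\<dots> = infsum ?g (range (\<lambda>s. 3 * s) \<union> range (\<lambda>s. 3 * s + 1))"
  proof (rule infsum_cong_neutral)
    fix N :: int assume "N \<in> UNIV - (range (\<lambda>s. 3 * s) \<union> range (\<lambda>s. 3 * s + 1))"
    then have n: "N \<noteq> 3 * s" "N \<noteq> 3 * s + 1" for s by auto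
    have "N = 3 * (N div 3) + 2"
      using n[of "N div 3"] by presburger
    then show "?g N = 0" using theta_mult_slice_2[OF z(1), of "N div 3"] by simp
  qed auto
  also have "\<dots> = infsum ?g (range (\<lambda>s. 3 * s)) + infsum ?g (range (\<lambda>s. 3 * s + 1))"
    by (rule infsum_Un_disjoint[OF g g]) (auto, presburger)
  also have "infsum ?g (range (\<lambda>s. 3 * s)) = (\<Sum>\<^sub>\<infinity>s. ?c * (z powi (3 * s) * q powi (3 * tri s + s)))"
    by (simp add: infsum_reindex[OF i0] o_def theta_mult_slice_0[OF z(1)])
  also have "\<dots> = (\<Sum>\<^sub>\<infinity>s. ?c * (z powi (- 3 * s) * q powi (3 * tri s + 2 * s)))"
    unfolding z3 using infsum_int_reflect[of "\<lambda>s. ?c * (z powi (3 * s) * q powi (3 * tri s + s))" 0] by simp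
  also have "infsum ?g (range (\<lambda>s. 3 * s + 1)) = (\<Sum>\<^sub>\<infinity>s. - (?c * (z powi (3 * s + 1) * q powi (3 * tri s + 2 * s))))"
    by (simp add: infsum_reindex[OF i1] o_def theta_mult_slice_1[OF z(1)])
  also have "(\<Sum>\<^sub>\<infinity>s. ?c * (z powi (- 3 * s) * q powi (3 * tri s + 2 * s))) + \<dots> =
    (\<Sum>\<^sub>\<infinity>s. ?c * (z powi (- 3 * s) * q powi (3 * tri s + 2 * s)) + - (?c * (z powi (3 * s + 1) * q powi (3 * tri s + 2 * s))))"
  proof (rule infsum_add[symmetric])
    have s: "(\<lambda>s. c powi s * q powi (int 3 * tri s + 2 * s)) summable_on UNIV" if "c \<noteq> 0" for c
      using abs_summable_summable[OF gauss_summable_power[OF that, of 3 2]] by simp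
    have "z powi (- 3 * s) = (z powi (- 3)) powi s" for s by (rule power_int_mult)
    moreover have "z powi (3 * s + 1) = z * (z powi 3) powi s" for s
      using z(1) power_int_mult[of z 3 s] by (simp add: power_int_add)
    ultimately show "(\<lambda>s. ?c * (z powi (- 3 * s) * q powi (3 * tri s + 2 * s))) summable_on UNIV"
      "(\<lambda>s. - (?c * (z powi (3 * s + 1) * q powi (3 * tri s + 2 * s)))) summable_on UNIV"
      using s[of "z powi (- 3)"] s[of "z powi 3"] z(1)
      by (simp_all only: mult.assoc of_nat_numeral minus_mult_left) (intro summable_on_cmult_right; simp)+
  qed
  also have "\<dots> = (\<Sum>\<^sub>\<infinity>s. ?c * (q powi (3 * tri s + 2 * s) * (z powi (- 3 * s) - z powi (3 * s + 1))))"
    by (intro infsum_cong) (simp add: algebra_simps)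
  also have "\<dots> = ?c * (\<Sum>\<^sub>\<infinity>s. q powi (3 * tri s + 2 * s) * (z powi (- 3 * s) - z powi (3 * s + 1)))"
    by (rule infsum_cmult_right')
  finally have "?\<theta> = ?c * (\<Sum>\<^sub>\<infinity>s. q powi (3 * tri s + 2 * s) * (z powi (- 3 * s) - z powi (3 * s + 1)))" .
  moreover have "theta z = qpochs_inf [q, z, q / z] q"
    by (rule theta_eq_prod[OF z(1,2)])
  moreover have "Q.theta (q * z\<^sup>2) = qpochs_inf [q\<^sup>2, q * z\<^sup>2, q\<^sup>2 / (q * z\<^sup>2)] (q\<^sup>2)"
  proof (rule Q.theta_eq_prod)
    fix m
    show "q * z\<^sup>2 \<noteq> (q\<^sup>2) powi m"
    proof
      assume "q * z\<^sup>2 = (q\<^sup>2) powi m"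
      then have "z\<^sup>2 = q powi (2 * m - 1)"
        using powi_of_power[of 2 m] by (simp add: power_int_diff field_simps)
      then show False using z(3) by blast
    qed
  qed (use z(1) in simp)
  moreover have "q\<^sup>2 / (q * z\<^sup>2) = q / z\<^sup>2" by (simp add: power2_eq_square)
  ultimately show ?thesis using c by (simp add: qpochs_inf_def mult_ac)
qed

end

section \<open>Residue classes modulo 2\<kappa> and the function P\<close>

lemma abs_summable_mult_inj:
  fixes f :: "'a \<Rightarrow> complex" and g :: "'b \<Rightarrow> complex"
  assumes "abs_summable f UNIV" "abs_summable g UNIV" "inj \<phi>"
  shows "abs_summable (\<lambda>x. f (fst (\<phi> x)) * g (snd (\<phi> x))) UNIV"
proof -
  have "(\<lambda>x. norm (case x of (x, y) \<Rightarrow> f x * g y)) summable_on range \<phi>"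
    using abs_summable_on_mult_Times[OF assms(1,2)] by (rule summable_on_subset_banach) auto
  then show ?thesis
    unfolding summable_on_reindex[OF assms(3)] by (simp add: o_def case_prod_unfold)
qed

text \<open>The terms are grouped in blocks of length 2\<kappa>; residues 0 and \<kappa> drop out
  and the others pair up as i and 2\<kappa> - i.\<close>

lemma sums_residues:
  fixes f :: "nat \<Rightarrow> complex"
  assumes f: "summable (\<lambda>n. norm (f n))" and "\<kappa> > 0"
    and 0: "\<And>n. f (2 * \<kappa> * n) = 0" "\<And>n. f (2 * \<kappa> * n + \<kappa>) = 0"
  shows "suminf f = (\<Sum>i\<in>{1..\<kappa> - 1}. (\<Sum>n. f (2 * \<kappa> * n + i)) + (\<Sum>n. f (2 * \<kappa> * n + (2 * \<kappa> - i))))"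
proof -
  have sub: "summable (\<lambda>n. f (2 * \<kappa> * n + c))" for c
  proof -
    have "inj (\<lambda>n. 2 * \<kappa> * n + c)" using \<open>\<kappa> > 0\<close> by (auto intro: injI)
    moreover have "f summable_on range (\<lambda>n. 2 * \<kappa> * n + c)"
      using norm_summable_imp_summable_on[OF f] by (rule summable_on_subset_banach) auto
    ultimately have "(\<lambda>n. f (2 * \<kappa> * n + c)) summable_on UNIV"
      by (simp add: summable_on_reindex o_def)
    then show ?thesis by (rule summable_on_imp_summable)
  qed
  have "(\<lambda>n. sum f {n * (2 * \<kappa>)..<n * (2 * \<kappa>) + 2 * \<kappa>}) sums suminf f"
    using \<open>\<kappa> > 0\<close> by (intro sums_group summable_sums summable_norm_cancel[OF f]) auto
  moreover have "sum f {n * (2 * \<kappa>)..<n * (2 * \<kappa>) + 2 * \<kappa>} =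
    (\<Sum>i\<in>{1..\<kappa> - 1}. f (2 * \<kappa> * n + i) + f (2 * \<kappa> * n + (2 * \<kappa> - i)))" for n
  proof -
    let ?h = "\<lambda>i. f (2 * \<kappa> * n + i)"
    have "sum f {n * (2 * \<kappa>)..<n * (2 * \<kappa>) + 2 * \<kappa>} = sum ?h {0..<2 * \<kappa>}"
      using sum.shift_bounds_nat_ivl[of f 0 "n * (2 * \<kappa>)" "2 * \<kappa>"] by (simp add: mult_ac add_ac)
    also have "{0..<2 * \<kappa>} = {0, \<kappa>} \<union> ({1..\<kappa> - 1} \<union> {\<kappa> + 1..2 * \<kappa> - 1})"
      using \<open>\<kappa> > 0\<close> by auto
    also have "sum ?h \<dots> = sum ?h {0, \<kappa>} + sum ?h ({1..\<kappa> - 1} \<union> {\<kappa> + 1..2 * \<kappa> - 1})"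
      by (rule sum.union_disjoint) (use \<open>\<kappa> > 0\<close> in auto)
    also have "sum ?h {0, \<kappa>} = 0" using 0 \<open>\<kappa> > 0\<close> by simp
    also have "sum ?h ({1..\<kappa> - 1} \<union> {\<kappa> + 1..2 * \<kappa> - 1}) = sum ?h {1..\<kappa> - 1} + sum ?h {\<kappa> + 1..2 * \<kappa> - 1}"
      by (rule sum.union_disjoint) auto
    also have "sum ?h {\<kappa> + 1..2 * \<kappa> - 1} = (\<Sum>i\<in>{1..\<kappa> - 1}. ?h (2 * \<kappa> - i))"
      by (rule sum.reindex_bij_witness[where i = "\<lambda>i. 2 * \<kappa> - i" and j = "\<lambda>i. 2 * \<kappa> - i"]) auto
    finally show ?thesis by (simp add: sum.distrib)
  qed
  ultimately have "(\<lambda>n. \<Sum>i\<in>{1..\<kappa> - 1}. f (2 * \<kappa> * n + i) + f (2 * \<kappa> * n + (2 * \<kappa> - i))) sums suminf f"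
    by simp
  moreover have "(\<lambda>n. \<Sum>i\<in>{1..\<kappa> - 1}. f (2 * \<kappa> * n + i) + f (2 * \<kappa> * n + (2 * \<kappa> - i))) sums
    (\<Sum>i\<in>{1..\<kappa> - 1}. (\<Sum>n. f (2 * \<kappa> * n + i)) + (\<Sum>n. f (2 * \<kappa> * n + (2 * \<kappa> - i))))"
    by (intro sums_sum sums_add summable_sums sub)
  ultimately show ?thesis by (rule sums_unique2)
qed

context nome
begin

definition U :: "nat \<Rightarrow> int \<Rightarrow> complex" where
  "U \<kappa> j = (\<Sum>\<^sub>\<infinity>s. q powi (int (6 * \<kappa>) * tri s + (4 * int \<kappa> - 3 * j) * s))"

text \<open>The series side of \<open>quintuple_product\<close> for base q^(2\<kappa>) and z = q^j.
  It is also defined at those j where that theorem does not apply.\<close>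

definition P :: "nat \<Rightarrow> int \<Rightarrow> complex" where
  "P \<kappa> j = (\<Sum>\<^sub>\<infinity>s. q powi (2 * int \<kappa> * (3 * tri s + 2 * s)) * (q powi (- 3 * s * j) - q powi (j * (3 * s + 1))))"

lemma P_term:
  "q powi (2 * int \<kappa> * (3 * tri s + 2 * s)) * (q powi (- 3 * s * j) - q powi (j * (3 * s + 1))) =
   q powi (int (6 * \<kappa>) * tri s + (4 * int \<kappa> - 3 * j) * s)
     - q powi j * q powi (int (6 * \<kappa>) * tri s + (4 * int \<kappa> - 3 * (- j)) * s)"
proof -
  have e: "int (6 * \<kappa>) * tri s + (4 * int \<kappa> - 3 * j) * s = 2 * int \<kappa> * (3 * tri s + 2 * s) + (- 3 * s * j)"
    "j + (int (6 * \<kappa>) * tri s + (4 * int \<kappa> - 3 * (- j)) * s) = 2 * int \<kappa> * (3 * tri s + 2 * s) + (j * (3 * s + 1))"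
    by (simp_all add: algebra_simps)
  have add: "q powi m * q powi n = q powi (m + n)" for m n by (simp add: power_int_add)
  show ?thesis
    unfolding right_diff_distrib add e ..
qed

lemma U_summable: "\<kappa> > 0 \<Longrightarrow> (\<lambda>s. q powi (int (6 * \<kappa>) * tri s + (4 * int \<kappa> - 3 * j) * s)) summable_on UNIV"
  using abs_summable_summable[OF gauss_summable_power[of 1 "6 * \<kappa>" "4 * int \<kappa> - 3 * j"]] by simp

lemma P_has_sum:
  assumes "\<kappa> > 0"
  shows "((\<lambda>s. q powi (2 * int \<kappa> * (3 * tri s + 2 * s)) * (q powi (- 3 * s * j) - q powi (j * (3 * s + 1)))) has_sum
    (U \<kappa> j - q powi j * U \<kappa> (- j))) UNIV"
  unfolding P_term U_def
  using has_sum_add[OF has_sum_infsum[OF U_summable[OF assms, of j]]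
      has_sum_uminusI[OF has_sum_cmult_right[OF has_sum_infsum[OF U_summable[OF assms, of "- j"]], of "q powi j"]]]
  by (simp only: add_uminus_conv_diff)

lemma P_eq: "\<kappa> > 0 \<Longrightarrow> P \<kappa> j = U \<kappa> j - q powi j * U \<kappa> (- j)"
  unfolding P_def by (rule infsumI[OF P_has_sum])

lemma U_shift: "U \<kappa> (j + 2 * int \<kappa>) = q powi (- 2 * int \<kappa> - 3 * j) * U \<kappa> j"
proof -
  have "q powi (int (6 * \<kappa>) * tri (s + 1) + (4 * int \<kappa> - 3 * (j + 2 * int \<kappa>)) * (s + 1)) =
    q powi (- 2 * int \<kappa> - 3 * j) * q powi (int (6 * \<kappa>) * tri s + (4 * int \<kappa> - 3 * j) * s)" for s
  proof -
    have "int (6 * \<kappa>) * tri (s + 1) + (4 * int \<kappa> - 3 * (j + 2 * int \<kappa>)) * (s + 1)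
      = (- 2 * int \<kappa> - 3 * j) + (int (6 * \<kappa>) * tri s + (4 * int \<kappa> - 3 * j) * s)"
      unfolding tri_add_1 by (simp add: algebra_simps)
    then show ?thesis by (metis power_int_add q_nonzero)
  qed
  then show ?thesis
    unfolding U_def
    using infsum_int_shift[of "\<lambda>s. q powi (int (6 * \<kappa>) * tri s + (4 * int \<kappa> - 3 * (j + 2 * int \<kappa>)) * s)" 1]
    by (simp only: infsum_cmult_right')
qed

text \<open>Shifting s by one in either half of the series reproduces that half up to a power of q,
  and the two factors agree.\<close>

lemma P_shift:
  assumes "\<kappa> > 0"
  shows "P \<kappa> (j + 2 * int \<kappa>) = q powi (- 2 * int \<kappa> - 3 * j) * P \<kappa> j"
proof -
  have "U \<kappa> (- j) = q powi (4 * int \<kappa> + 3 * j) * U \<kappa> (- (j + 2 * int \<kappa>))"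
    using U_shift[of \<kappa> "- (j + 2 * int \<kappa>)"] by (simp add: algebra_simps)
  moreover have "q powi (- 2 * int \<kappa> - 3 * j) * (q powi j * q powi (4 * int \<kappa> + 3 * j)) = q powi (j + 2 * int \<kappa>)"
    by (simp flip: power_int_add)
  ultimately show ?thesis
    unfolding P_eq[OF assms] U_shift by (simp add: right_diff_distrib mult.assoc[symmetric])
qed

lemma P_uminus:
  assumes "\<kappa> > 0"
  shows "P \<kappa> (- j) = - (q powi (- j)) * P \<kappa> j"
  unfolding P_eq[OF assms] by (simp add: right_diff_distrib mult.assoc[symmetric] flip: power_int_add)

lemma P_0: "\<kappa> > 0 \<Longrightarrow> P \<kappa> 0 = 0"
  by (simp add: P_eq)

text \<open>As \<kappa> and -\<kappa> differ by the quasi-period, the shift and the antisymmetry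
  together give P = -P.\<close>

lemma P_self:
  assumes "\<kappa> > 0"
  shows "P \<kappa> (int \<kappa>) = 0"
proof -
  have "P \<kappa> (int \<kappa>) = q powi (int \<kappa>) * P \<kappa> (- int \<kappa>)"
    using P_shift[OF assms, of "- int \<kappa>"] by simp
  also have "\<dots> = - P \<kappa> (int \<kappa>)"
    unfolding P_uminus[OF assms] by (simp add: power_int_minus)
  finally show ?thesis by simp
qed

lemma P_eq_prod:
  assumes "1 \<le> i" "i < \<kappa>"
  shows "P \<kappa> (int i) = qpochs_inf [q ^ i, q ^ (2 * \<kappa> - i), q ^ (2 * \<kappa>)] (q ^ (2 * \<kappa>))
             * qpochs_inf [q ^ (2 * \<kappa> - 2 * i), q ^ (2 * \<kappa> + 2 * i)] (q ^ (4 * \<kappa>))"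
proof -
  interpret p: nome "q ^ (2 * \<kappa>)" using assms by (intro nome_power) auto
  have pow: "(q ^ (2 * \<kappa>)) powi m = q powi (2 * int \<kappa> * m)" for m
    using powi_of_power[of "2 * \<kappa>" m] by simp
  have zpow: "(q ^ i) powi m = q powi (m * int i)" for m
    using powi_of_power[of i m] by (simp add: mult.commute)
  have "P \<kappa> (int i) = (\<Sum>\<^sub>\<infinity>s. (q ^ (2 * \<kappa>)) powi (3 * tri s + 2 * s) * ((q ^ i) powi (- 3 * s) - (q ^ i) powi (3 * s + 1)))"
    unfolding P_def pow zpow by (simp add: mult.commute)
  also have "\<dots> = qpochs_inf [q ^ (2 * \<kappa>), q ^ i, q ^ (2 * \<kappa>) / q ^ i] (q ^ (2 * \<kappa>))
    * qpochs_inf [q ^ (2 * \<kappa>) * (q ^ i)\<^sup>2, q ^ (2 * \<kappa>) / (q ^ i)\<^sup>2] ((q ^ (2 * \<kappa>))\<^sup>2)"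
  proof (rule p.quintuple_product)
    \<comment> \<open>For 1 <= i < \<kappa> neither i nor 2i is a multiple of 2\<kappa>, which keeps
      z = q^i and its square off the powers of the base.\<close>
    have no: "j \<noteq> 2 * int \<kappa> * m" if "0 < j" "j < 2 * int \<kappa>" for j m
    proof
      assume "j = 2 * int \<kappa> * m"
      then have "2 * int \<kappa> dvd j" by simp
      then show False using that zdvd_imp_le by fastforce
    qed
    fix m
    show "q ^ i \<noteq> (q ^ (2 * \<kappa>)) powi m"
      using powi_q_inj[of "int i" "2 * int \<kappa> * m"] no[of "int i" m] assms unfolding pow power_int_of_nat by auto
    show "(q ^ i)\<^sup>2 \<noteq> (q ^ (2 * \<kappa>)) powi m"
      using powi_q_inj[of "int (i * 2)" "2 * int \<kappa> * m"] no[of "int (i * 2)" m] assms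
      unfolding pow power_mult[symmetric] power_int_of_nat by auto
  qed simp
  also have "q ^ (2 * \<kappa>) / q ^ i = q ^ (2 * \<kappa> - i)"
    using assms by (simp add: power_diff)
  also have "q ^ (2 * \<kappa>) / (q ^ i)\<^sup>2 = q ^ (2 * \<kappa> - 2 * i)"
    using assms by (simp add: power_diff power_mult mult.commute[of 2 i])
  also have "q ^ (2 * \<kappa>) * (q ^ i)\<^sup>2 = q ^ (2 * \<kappa> + 2 * i)"
    by (simp add: power_add mult.commute[of 2 i] flip: power_mult)
  also have "(q ^ (2 * \<kappa>))\<^sup>2 = q ^ (4 * \<kappa>)"
    by (simp flip: power_mult)
  finally show ?thesis by (simp add: qpochs_inf_def mult_ac)
qed

end

section \<open>The double series over s and j, and its coefficients T\<close>

context nome_param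
begin

text \<open>Minus this is the sum over s, at fixed j, of the double series that comes from
  \<open>R\<close>.\<close>

definition T :: "nat \<Rightarrow> int \<Rightarrow> complex" where
  "T \<kappa> j = (- a) powi j * t j * P \<kappa> j"

lemma T_shift:
  assumes "\<kappa> > 0"
  shows "T \<kappa> (j + 2 * int \<kappa>) = a ^ (2 * \<kappa>) * q powi ((2 * int \<kappa> - 3) * (int \<kappa> + j)) * T \<kappa> j"
proof -
  have "tri (2 * int \<kappa>) = int \<kappa> * (2 * int \<kappa> - 1)"
    using two_tri[of "2 * int \<kappa>"] by simp
  then have "tri (j + 2 * int \<kappa>) + (- 2 * int \<kappa> - 3 * j) = tri j + (2 * int \<kappa> - 3) * (int \<kappa> + j)"
    by (simp add: tri_add algebra_simps)
  then have "t (j + 2 * int \<kappa>) * q powi (- 2 * int \<kappa> - 3 * j) = t j * q powi ((2 * int \<kappa> - 3) * (int \<kappa> + j))"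
    by (metis power_int_add q_nonzero)
  moreover have "(- a) powi (j + 2 * int \<kappa>) = (- a) powi j * a ^ (2 * \<kappa>)"
    using powi_uminus_even[of a "int \<kappa>"] power_int_of_nat[of a "2 * \<kappa>"] by (simp add: power_int_add)
  ultimately show ?thesis
    unfolding T_def P_shift[OF assms] by (simp add: mult_ac)
qed

text \<open>The exponents (2\<kappa>-3)(\<kappa> + j + 2\<kappa> l), l < n, add up because the first
  n odd numbers sum to n^2.\<close>

lemma T_shift_mult:
  assumes "\<kappa> > 0"
  shows "T \<kappa> (j + 2 * int \<kappa> * int n) = a ^ (2 * \<kappa> * n) * q powi ((2 * int \<kappa> - 3) * (int \<kappa> * int n + j) * int n) * T \<kappa> j"
proof (induction n)
  case (Suc n)
  have "T \<kappa> (j + 2 * int \<kappa> * int (Suc n)) = T \<kappa> ((j + 2 * int \<kappa> * int n) + 2 * int \<kappa>)"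
    by (simp add: algebra_simps)
  also have "\<dots> = (a ^ (2 * \<kappa>) * a ^ (2 * \<kappa> * n)) * (q powi ((2 * int \<kappa> - 3) * (int \<kappa> + (j + 2 * int \<kappa> * int n)))
    * q powi ((2 * int \<kappa> - 3) * (int \<kappa> * int n + j) * int n)) * T \<kappa> j"
    unfolding T_shift[OF assms] Suc.IH by (simp only: mult_ac)
  also have "a ^ (2 * \<kappa>) * a ^ (2 * \<kappa> * n) = a ^ (2 * \<kappa> * Suc n)" by (simp add: power_add)
  also have "q powi ((2 * int \<kappa> - 3) * (int \<kappa> + (j + 2 * int \<kappa> * int n))) * q powi ((2 * int \<kappa> - 3) * (int \<kappa> * int n + j) * int n)
    = q powi ((2 * int \<kappa> - 3) * (int \<kappa> * int (Suc n) + j) * int (Suc n))"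
  proof -
    have "(2 * int \<kappa> - 3) * (int \<kappa> * int (Suc n) + j) * int (Suc n) =
      (2 * int \<kappa> - 3) * (int \<kappa> + (j + 2 * int \<kappa> * int n)) + (2 * int \<kappa> - 3) * (int \<kappa> * int n + j) * int n"
      by (simp add: algebra_simps)
    then show ?thesis by (metis power_int_add q_nonzero)
  qed
  finally show ?case .
qed simp

lemma T_uminus:
  assumes "\<kappa> > 0"
  shows "T \<kappa> (- j) = - (a powi (- 2 * j)) * T \<kappa> j"
proof -
  have "(- a) powi (- j) = (- a) powi j * a powi (- 2 * j)"
  proof -
    have "(- a) powi (j + 2 * (- j)) = (- a) powi j * (- a) powi (2 * (- j))" by (rule power_int_add) simp
    then show ?thesis unfolding powi_uminus_even by simp
  qed
  moreover have "t (- j) * q powi (- j) = t j"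
    unfolding tri_uminus by (simp flip: power_int_add)
  ultimately show ?thesis
    unfolding T_def P_uminus[OF assms] by (simp add: mult_ac)
qed

text \<open>Writing (-a)^j through the powers 3s and 3s+1 +- j turns each half into a product of one
  Gaussian term in s and one in 3s+1 +- j. The maps (s,j) -> (s, 3s+1 +- j) are injective, so
  products of summable families dominate both halves.\<close>

lemma theta_part_summable:
  fixes N :: nat
  assumes "N > 0"
  shows "abs_summable (\<lambda>(s, j). (- a) ^ j * (q powi (int N * (3 * tri s + 2 * s)) * (t (3 * s + 1 + int j) - t (3 * s + 1 - int j)))) UNIV"
proof -
  let ?Q = "\<lambda>s. q powi (int (3 * N) * tri s + (2 * int N) * s)"
  have Q: "q powi (int N * (3 * tri s + 2 * s)) = ?Q s" for s
    by (simp add: algebra_simps)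
  have p: "abs_summable (\<lambda>x. (((- a) powi (- 3)) powi fst x * ?Q (fst x)) *
      ((- a) powi (3 * fst x + 1 + int (snd x)) * t (3 * fst x + 1 + int (snd x)))) UNIV"
    using abs_summable_mult_inj[OF gauss_summable_power[of "(- a) powi (- 3)" "3 * N" "2 * int N"] gauss_summable[of "- a"],
      of "\<lambda>x. (fst x, 3 * fst x + 1 + int (snd x))"] assms
    by (auto simp: inj_on_def prod_eq_iff)
  have m: "abs_summable (\<lambda>x. (((- a) powi 3) powi fst x * ?Q (fst x)) *
      ((1 / (- a)) powi (3 * fst x + 1 - int (snd x)) * t (3 * fst x + 1 - int (snd x)))) UNIV"
    using abs_summable_mult_inj[OF gauss_summable_power[of "(- a) powi 3" "3 * N" "2 * int N"] gauss_summable[of "1 / (- a)"],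
      of "\<lambda>x. (fst x, 3 * fst x + 1 - int (snd x))"] assms
    by (auto simp: inj_on_def prod_eq_iff)
  show ?thesis
  proof (rule Infinite_Sum.abs_summable_on_comparison_test')
    fix x :: "int \<times> nat"
    obtain s j where x: "x = (s, j)" by (cases x)
    have 1: "(- a) ^ j = 1 / (- a) * (((- a) powi (- 3)) powi s * (- a) powi (3 * s + 1 + int j))"
    proof -
      have "((- a) powi (- 3)) powi s * (- a) powi (3 * s + 1 + int j) = (- a) powi (- 3 * s + (3 * s + 1 + int j))"
        unfolding power_int_mult[symmetric] by (simp only: power_int_add neg_equal_0_iff_equal a_nonzero simp_thms)
      also have "\<dots> = (- a) * (- a) ^ j" by (simp add: power_int_add)
      finally show ?thesis by simp
    qed
    have 2: "(- a) ^ j = (- a) * (((- a) powi 3) powi s * (1 / (- a)) powi (3 * s + 1 - int j))"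
    proof -
      have "(1 / (- a)) powi (3 * s + 1 - int j) = (- a) powi (int j - 1 - 3 * s)"
      proof -
        have "(1 / (- a)) powi (3 * s + 1 - int j) = inverse ((- a) powi (3 * s + 1 - int j))"
          by (metis power_int_inverse inverse_eq_divide)
        also have "\<dots> = (- a) powi (- (3 * s + 1 - int j))" by (rule power_int_minus[symmetric])
        finally show ?thesis by (simp add: algebra_simps)
      qed
      then have "((- a) powi 3) powi s * (1 / (- a)) powi (3 * s + 1 - int j) = (- a) powi (3 * s + (int j - 1 - 3 * s))"
        unfolding power_int_mult[symmetric] by (simp only: power_int_add neg_equal_0_iff_equal a_nonzero simp_thms)
      also have "\<dots> = (- a) ^ j / (- a)" by (simp add: power_int_diff)
      finally show ?thesis by simp
    qed
    let ?A = "(((- a) powi (- 3)) powi s * ?Q s) * ((- a) powi (3 * s + 1 + int j) * t (3 * s + 1 + int j))"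
    let ?B = "(((- a) powi 3) powi s * ?Q s) * ((1 / (- a)) powi (3 * s + 1 - int j) * t (3 * s + 1 - int j))"
    have "(- a) ^ j * (?Q s * (t (3 * s + 1 + int j) - t (3 * s + 1 - int j))) = 1 / (- a) * ?A - (- a) * ?B"
    (is "?L = _")
    proof -
      have "(- a) ^ j * (?Q s * t (3 * s + 1 + int j)) = 1 / (- a) * ?A" by (subst 1) (simp only: mult_ac)
      moreover have "(- a) ^ j * (?Q s * t (3 * s + 1 - int j)) = (- a) * ?B" by (subst 2) (simp only: mult_ac)
      ultimately show ?thesis by (simp only: right_diff_distrib)
    qed
    then have "norm ?L \<le> norm (1 / (- a)) * norm ?A + norm (- a) * norm ?B"
      unfolding norm_mult[of "1 / (- a)", symmetric] norm_mult[of "- a" ?B, symmetric]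
      by (simp only: norm_triangle_ineq4)
    then show "norm (case x of (s, j) \<Rightarrow> (- a) ^ j * (q powi (int N * (3 * tri s + 2 * s)) * (t (3 * s + 1 + int j) - t (3 * s + 1 - int j))))
      \<le> norm (1 / (- a)) * norm ((((- a) powi (- 3)) powi fst x * ?Q (fst x)) *
          ((- a) powi (3 * fst x + 1 + int (snd x)) * t (3 * fst x + 1 + int (snd x))))
       + norm (- a) * norm ((((- a) powi 3) powi fst x * ?Q (fst x)) *
          ((1 / (- a)) powi (3 * fst x + 1 - int (snd x)) * t (3 * fst x + 1 - int (snd x))))"
      unfolding x Q by simp
  qed (intro summable_on_add summable_on_cmult_right p m)
qed

text \<open>In binom(3s+1 +- j, 2) the part binom(3s+1, 2) raises N to 2\<kappa>. The cross term
  -j(3s+1) combines with binom(-j,2) = binom(j,2) + j to -3sj. The outer minus sign comes from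
  exchanging the two terms of the bracket.\<close>

lemma theta_part_eq:
  assumes "2 * int \<kappa> = int N + 3"
  shows "(- a) ^ j * (q powi (int N * (3 * tri s + 2 * s)) * (t (3 * s + 1 + int j) - t (3 * s + 1 - int j))) =
    - ((- a) powi int j * t (int j)) * (q powi (2 * int \<kappa> * (3 * tri s + 2 * s)) * (q powi (- 3 * s * int j) - q powi (int j * (3 * s + 1))))"
proof -
  have tri: "tri (3 * s + 1) = 3 * (3 * tri s + 2 * s)"
  proof -
    have "2 * tri (3 * s + 1) = 2 * (3 * (3 * tri s + 2 * s))"
      using two_tri[of s] two_tri[of "3 * s + 1"] by (simp add: algebra_simps)
    then show ?thesis by simp
  qed
  have add: "q powi m * q powi n = q powi (m + n)" for m n by (simp add: power_int_add)
  have "int N * (3 * tri s + 2 * s) + tri (3 * s + 1 + int j) = tri (int j) + (2 * int \<kappa> * (3 * tri s + 2 * s) + int j * (3 * s + 1))"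
    unfolding tri_add[of "3 * s + 1"] tri assms by (simp add: algebra_simps)
  then have 1: "q powi (int N * (3 * tri s + 2 * s)) * t (3 * s + 1 + int j) =
    t (int j) * (q powi (2 * int \<kappa> * (3 * tri s + 2 * s)) * q powi (int j * (3 * s + 1)))"
    unfolding add by (rule arg_cong)
  have "int N * (3 * tri s + 2 * s) + tri (3 * s + 1 + - int j) = tri (int j) + (2 * int \<kappa> * (3 * tri s + 2 * s) + - 3 * s * int j)"
    unfolding tri_add[of "3 * s + 1"] tri tri_uminus assms by (simp add: algebra_simps)
  then have 2: "q powi (int N * (3 * tri s + 2 * s)) * t (3 * s + 1 - int j) =
    t (int j) * (q powi (2 * int \<kappa> * (3 * tri s + 2 * s)) * q powi (- 3 * s * int j))"
    unfolding add diff_conv_add_uminus by (rule arg_cong)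
  show ?thesis
    unfolding right_diff_distrib[of "q powi (int N * (3 * tri s + 2 * s))"] 1 2
    by (simp add: algebra_simps)
qed

text \<open>One value X for both orders of summation: inside, j gives \<open>R\<close> and s gives
  \<open>P\<close>.\<close>

lemma theta_part_has_sum:
  assumes "2 * int \<kappa> = int N + 3" "N > 0" "\<kappa> > 0"
  obtains X where "((\<lambda>s. q powi (int N * (3 * tri s + 2 * s)) * R (3 * s)) has_sum X) UNIV"
    and "((\<lambda>j. - T \<kappa> (int j)) has_sum X) UNIV"
proof -
  let ?F = "\<lambda>(s :: int, j). (- a) ^ j * (q powi (int N * (3 * tri s + 2 * s)) * (t (3 * s + 1 + int j) - t (3 * s + 1 - int j)))"
  have "?F summable_on UNIV \<times> UNIV"
    using abs_summable_summable[OF theta_part_summable[OF assms(2)]] by simp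
  then obtain X where X: "(?F has_sum X) (UNIV \<times> UNIV)" by (auto simp: summable_on_def)
  have "((\<lambda>s. q powi (int N * (3 * tri s + 2 * s)) * R (3 * s)) has_sum X) UNIV"
  proof (rule has_sum_SigmaD[OF X])
    fix s :: int
    have "(\<lambda>j. ?F (s, j)) summable_on UNIV"
      using summable_on_SigmaD1[OF has_sum_imp_summable[OF X], of s] by simp
    then have h: "((\<lambda>j. ?F (s, j)) has_sum (\<Sum>\<^sub>\<infinity>j. ?F (s, j))) UNIV" by (rule has_sum_infsum)
    have "(\<lambda>j. q powi (int N * (3 * tri s + 2 * s)) * ((- a) ^ j * (t (3 * s + 1 + int j) - t (3 * s + 1 - int j)))) sums
      (q powi (int N * (3 * tri s + 2 * s)) * R (3 * s))"
      unfolding R_def by (intro sums_mult summable_sums R_summable)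
    then have "(\<lambda>j. ?F (s, j)) sums (q powi (int N * (3 * tri s + 2 * s)) * R (3 * s))"
      by (simp add: mult.left_commute)
    then have "(\<Sum>\<^sub>\<infinity>j. ?F (s, j)) = q powi (int N * (3 * tri s + 2 * s)) * R (3 * s)"
      using has_sum_imp_sums[OF h] by (rule sums_unique2[rotated])
    then show "((\<lambda>j. ?F (s, j)) has_sum q powi (int N * (3 * tri s + 2 * s)) * R (3 * s)) UNIV"
      using h by simp
  qed
  moreover have "((\<lambda>j. - T \<kappa> (int j)) has_sum X) UNIV"
  proof -
    have "bij_betw prod.swap (UNIV \<times> UNIV :: (nat \<times> int) set) (UNIV \<times> UNIV)"
      by (rule bij_betwI[where g = prod.swap]) auto
    then have "((\<lambda>x. ?F (prod.swap x)) has_sum X) (UNIV \<times> UNIV)"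
      using X by (subst has_sum_reindex_bij_betw)
    then show ?thesis
    proof (rule has_sum_SigmaD)
      fix j :: nat
      have "((\<lambda>s. - ((- a) powi int j * t (int j)) * (q powi (2 * int \<kappa> * (3 * tri s + 2 * s)) * (q powi (- 3 * s * int j) - q powi (int j * (3 * s + 1)))))
        has_sum - ((- a) powi int j * t (int j)) * P \<kappa> (int j)) UNIV"
        unfolding P_eq[OF assms(3)] by (intro has_sum_cmult_right P_has_sum assms(3))
      then show "((\<lambda>s. ?F (prod.swap (j, s))) has_sum - T \<kappa> (int j)) UNIV"
        by (simp add: T_def theta_part_eq[OF assms(1)] del: power_int_of_nat)
    qed
  qed
  ultimately show ?thesis using that by blast
qed

text \<open>The index i itself gives the 1 in the bracket. The other indices occur in pairs
  2\<kappa> n + i and 2\<kappa> n - i with n >= 1, both multiples of T(i) by quasi-periodicity and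
  reflection.\<close>

lemma T_suminf:
  assumes "\<kappa> > 0" and s: "summable (\<lambda>j. norm (T \<kappa> (int j)))"
  shows "(\<Sum>j. T \<kappa> (int j)) = (\<Sum>i\<in>{1..\<kappa> - 1}. T \<kappa> (int i) *
    (1 - (\<Sum>m. let n = Suc m in a ^ (2 * \<kappa> * n - 2 * i) * q powi ((2 * int \<kappa> - 3) * (int \<kappa> * int n - int i) * int n)
                    * (1 - a ^ (2 * i) * q powi (2 * (2 * int \<kappa> - 3) * int i * int n)))))"
proof -
  have T0: "T \<kappa> (int (2 * \<kappa> * n)) = 0" "T \<kappa> (int (2 * \<kappa> * n + \<kappa>)) = 0" for n
    using T_shift_mult[OF assms(1), of 0 n] T_shift_mult[OF assms(1), of "int \<kappa>" n]
    by (simp_all add: T_def P_0[OF assms(1)] P_self[OF assms(1)] add.commute)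
  have sub: "summable (\<lambda>n. T \<kappa> (int (2 * \<kappa> * n + c)))" for c
  proof -
    have "inj (\<lambda>n. 2 * \<kappa> * n + c)" using \<open>\<kappa> > 0\<close> by (auto intro: injI)
    moreover have "(\<lambda>j. T \<kappa> (int j)) summable_on range (\<lambda>n. 2 * \<kappa> * n + c)"
      using norm_summable_imp_summable_on[OF s] by (rule summable_on_subset_banach) auto
    ultimately have "(\<lambda>n. T \<kappa> (int (2 * \<kappa> * n + c))) summable_on UNIV"
      by (simp only: summable_on_reindex o_def)
    then show ?thesis by (rule summable_on_imp_summable)
  qed
  have "(\<Sum>n. T \<kappa> (int (2 * \<kappa> * n + i))) + (\<Sum>n. T \<kappa> (int (2 * \<kappa> * n + (2 * \<kappa> - i)))) =
    T \<kappa> (int i) * (1 - (\<Sum>m. let n = Suc m in a ^ (2 * \<kappa> * n - 2 * i) * q powi ((2 * int \<kappa> - 3) * (int \<kappa> * int n - int i) * int n)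
                    * (1 - a ^ (2 * i) * q powi (2 * (2 * int \<kappa> - 3) * int i * int n))))"
    if i: "i \<in> {1..\<kappa> - 1}" for i
  \<comment> \<open>Summability of the bracketed series is obtained by dividing by T(i); if T(i) =
    0, both sides vanish instead.\<close>
  proof (cases "T \<kappa> (int i) = 0")
    case True
    have "T \<kappa> (int (2 * \<kappa> * n + i)) = 0" for n
      using T_shift_mult[OF assms(1), of "int i" n] True by (simp add: add.commute)
    moreover have "T \<kappa> (int (2 * \<kappa> * n + (2 * \<kappa> - i))) = 0" for n
    proof -
      have "i \<le> 2 * \<kappa>" using i by auto
      then have "int (2 * \<kappa> * n + (2 * \<kappa> - i)) = - int i + 2 * int \<kappa> * int (Suc n)"
        by (simp add: of_nat_diff algebra_simps)
      then show ?thesis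
        using True by (simp only: T_shift_mult[OF assms(1)] T_uminus[OF assms(1)] mult_zero_right)
    qed
    ultimately show ?thesis using True by simp
  next
    case False
    let ?g = "\<lambda>n. a ^ (2 * \<kappa> * n - 2 * i) * q powi ((2 * int \<kappa> - 3) * (int \<kappa> * int n - int i) * int n)
                    * (1 - a ^ (2 * i) * q powi (2 * (2 * int \<kappa> - 3) * int i * int n))"
    have g: "T \<kappa> (int (2 * \<kappa> * Suc m + i)) + T \<kappa> (int (2 * \<kappa> * m + (2 * \<kappa> - i))) = - (T \<kappa> (int i) * ?g (Suc m))" for m
    proof -
      define n where "n = Suc m"
      have "int (2 * \<kappa> * Suc m + i) = int i + 2 * int \<kappa> * int n"
        by (simp add: n_def algebra_simps)
      then have 1: "T \<kappa> (int (2 * \<kappa> * Suc m + i)) = a ^ (2 * \<kappa> * n) * q powi ((2 * int \<kappa> - 3) * (int \<kappa> * int n + int i) * int n) * T \<kappa> (int i)"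
        by (simp only: T_shift_mult[OF assms(1)])
      have "i \<le> 2 * \<kappa>" using i by auto
      then have "int (2 * \<kappa> * m + (2 * \<kappa> - i)) = - int i + 2 * int \<kappa> * int n"
        by (simp add: n_def of_nat_diff algebra_simps)
      then have 2: "T \<kappa> (int (2 * \<kappa> * m + (2 * \<kappa> - i))) =
        a ^ (2 * \<kappa> * n) * q powi ((2 * int \<kappa> - 3) * (int \<kappa> * int n - int i) * int n) * (- (a powi (- 2 * int i)) * T \<kappa> (int i))"
        by (simp only: T_shift_mult[OF assms(1)] T_uminus[OF assms(1)] add_uminus_conv_diff)
      \<comment> \<open>Ensures that the truncated difference in the exponent of a is a true
        one.\<close>
      have "2 * i \<le> 2 * \<kappa> * n"
      proof -
        have "i \<le> \<kappa>" "1 \<le> n" using i by (auto simp: n_def)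
        then have "i * 1 \<le> \<kappa> * n" by (rule mult_le_mono)
        then show ?thesis by simp
      qed
      then have a1: "a ^ (2 * \<kappa> * n) = a ^ (2 * \<kappa> * n - 2 * i) * a ^ (2 * i)"
        by (simp flip: power_add)
      have a2: "a ^ (2 * i) * a powi (- 2 * int i) = 1"
        using power_int_of_nat[of a "2 * i"] by (simp add: power_int_minus)
      have "(2 * int \<kappa> - 3) * (int \<kappa> * int n + int i) * int n = (2 * int \<kappa> - 3) * (int \<kappa> * int n - int i) * int n + 2 * (2 * int \<kappa> - 3) * int i * int n"
        by (simp add: algebra_simps)
      then have q1: "q powi ((2 * int \<kappa> - 3) * (int \<kappa> * int n + int i) * int n) =
        q powi ((2 * int \<kappa> - 3) * (int \<kappa> * int n - int i) * int n) * q powi (2 * (2 * int \<kappa> - 3) * int i * int n)"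
        by (simp only: power_int_add q_nonzero simp_thms)
      define u v b c where "u = a ^ (2 * \<kappa> * n - 2 * i)" and "v = a ^ (2 * i)" and "b = a powi (- 2 * int i)"
        and "c = T \<kappa> (int i)"
      have vb: "v * b = 1" using a2 by (simp add: v_def b_def)
      define X Y where "X = q powi ((2 * int \<kappa> - 3) * (int \<kappa> * int n - int i) * int n)"
        and "Y = q powi (2 * (2 * int \<kappa> - 3) * int i * int n)"
      have "u * v * (X * Y) * c + u * v * X * (- b * c) = - (c * (u * X * (1 - v * Y))) + u * X * c * (1 - v * b)"
        by (simp add: algebra_simps)
      then show ?thesis
        unfolding 1 2 vb
        unfolding a1 q1 n_def[symmetric] u_def[symmetric] v_def[symmetric] b_def[symmetric] c_def[symmetric]
          X_def[symmetric] Y_def[symmetric] by simp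
    qed
    have s1: "summable (\<lambda>m. T \<kappa> (int (2 * \<kappa> * Suc m + i)))"
      using sub[of i] by (subst summable_Suc_iff)
    have s2: "summable (\<lambda>m. T \<kappa> (int (2 * \<kappa> * m + (2 * \<kappa> - i))))" by (rule sub)
    have s3: "summable (\<lambda>m. ?g (Suc m))"
      using summable_add[OF s1 s2] False unfolding g summable_minus_iff by (subst (asm) summable_cmult_iff) simp
    have "(\<Sum>n. T \<kappa> (int (2 * \<kappa> * n + i))) + (\<Sum>n. T \<kappa> (int (2 * \<kappa> * n + (2 * \<kappa> - i)))) =
      T \<kappa> (int i) + ((\<Sum>m. T \<kappa> (int (2 * \<kappa> * Suc m + i))) + (\<Sum>n. T \<kappa> (int (2 * \<kappa> * n + (2 * \<kappa> - i)))))"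
      using suminf_split_head[OF sub[of i]] by (simp add: algebra_simps)
    also have "(\<Sum>m. T \<kappa> (int (2 * \<kappa> * Suc m + i))) + (\<Sum>n. T \<kappa> (int (2 * \<kappa> * n + (2 * \<kappa> - i)))) =
      - (T \<kappa> (int i) * (\<Sum>m. ?g (Suc m)))"
      unfolding suminf_add[OF s1 s2] g suminf_minus[OF summable_mult[OF s3]] suminf_mult[OF s3] ..
    finally show ?thesis by (simp add: Let_def right_diff_distrib[of "T \<kappa> (int i)" 1])
  qed
  then show ?thesis
    unfolding sums_residues[of "\<lambda>j. T \<kappa> (int j)", OF s assms(1) T0] by (intro sum.cong refl)
qed

section \<open>The pure powers of a, and assembly\<close>

lemma e_series:
  assumes s: "(\<lambda>s. q powi (int N * (3 * tri s + 2 * s)) * e (3 * s)) summable_on UNIV"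
  shows "(\<Sum>\<^sub>\<infinity>s. q powi (int N * (3 * tri s + 2 * s)) * e (3 * s)) =
    (\<Sum>n. (-1) ^ n * a ^ (3 * n) * q ^ (N * ((3 * n + 1) * n div 2)) * (1 - a\<^sup>2 * q ^ (N * (2 * n + 1))))"
proof -
  let ?f = "\<lambda>s. q powi (int N * (3 * tri s + 2 * s)) * e (3 * s)"
  have abs: "abs_summable ?f UNIV"
    using s by (simp only: summable_on_iff_abs_summable_on_complex)
  note split = infsum_int_split[OF abs]
  \<comment> \<open>The indices n and -1-n are paired: -1 - 3(-1-n) = 3n + 2 yields the a^2 in the
    second term, and oddness its sign.\<close>
  have "?f (int n) + ?f (- 1 - int n) =
    (-1) ^ n * a ^ (3 * n) * q ^ (N * ((3 * n + 1) * n div 2)) * (1 - a\<^sup>2 * q ^ (N * (2 * n + 1)))" for n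
  proof -
    have h: "int ((3 * n + 1) * n div 2) = 3 * tri (int n) + 2 * int n"
    proof -
      have "2 * (3 * tri (int n) + 2 * int n) = int ((3 * n + 1) * n)"
        using two_tri[of "int n"] by (simp add: algebra_simps)
      then have "int ((3 * n + 1) * n) div 2 = 3 * tri (int n) + 2 * int n"
        by (metis nonzero_mult_div_cancel_left zero_neq_numeral)
      then show ?thesis unfolding zdiv_int of_nat_numeral .
    qed
    then have "int N * (3 * tri (int n) + 2 * int n) = int (N * ((3 * n + 1) * n div 2))" by (simp only: of_nat_mult)
    then have 1: "q powi (int N * (3 * tri (int n) + 2 * int n)) = q ^ (N * ((3 * n + 1) * n div 2))"
      by (metis power_int_of_nat)
    have "int N * (3 * tri (- 1 - int n) + 2 * (- 1 - int n)) = int (N * ((3 * n + 1) * n div 2)) + int (N * (2 * n + 1))"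
    proof -
      have "tri (- 1 - int n) = tri (int n) + 2 * int n + 1"
        using tri_reflect[of "- 1 - int n"] tri_add[of "int n" 2] by (simp add: tri_def add.commute)
      then show ?thesis unfolding of_nat_mult h by (simp add: algebra_simps)
    qed
    then have 2: "q powi (int N * (3 * tri (- 1 - int n) + 2 * (- 1 - int n))) =
        q ^ (N * ((3 * n + 1) * n div 2)) * q ^ (N * (2 * n + 1))"
      by (metis power_add power_int_of_nat of_nat_add)
    have 3: "e (3 * int n) = (-1) ^ n * a ^ (3 * n)"
    proof -
      have "e (3 * int n) = (- a) ^ (3 * n)"
        using power_int_of_nat[of "- a" "3 * n"] by (simp add: e_def)
      also have "\<dots> = ((- a) ^ 3) ^ n" by (rule power_mult)
      also have "(- a) ^ 3 = (- 1) * a ^ 3" by simp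
      finally show ?thesis by (simp only: power_mult_distrib power_mult)
    qed
    have 4: "e (3 * (- 1 - int n)) = - ((-1) ^ n * a ^ (3 * n) * a\<^sup>2)"
    proof -
      have "e (3 * (- 1 - int n)) = - ((- a) powi (int (3 * n + 2)))"
        by (simp add: e_def algebra_simps)
      also have "\<dots> = - ((- a) ^ (3 * n) * (- a)\<^sup>2)"
        by (simp only: power_int_of_nat power_add)
      also have "(- a) ^ (3 * n) = (-1) ^ n * a ^ (3 * n)"
        using 3 power_int_of_nat[of "- a" "3 * n"] by (simp add: e_def)
      finally show ?thesis by simp
    qed
    show ?thesis unfolding 1 2 3 4 by (simp add: algebra_simps)
  qed
  then show ?thesis
    unfolding split(1) suminf_add[OF split(2,3)] by simp
qed

lemma main_expansion:
  assumes k: "k \<ge> 1" "\<kappa> = 3 * k - 1"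
  shows "(\<lambda>n. V n * q ^ n * inner_sum k q n) sums
    ((\<Sum>n. (-1) ^ n * a ^ (3 * n) * q ^ ((2 * \<kappa> - 3) * ((3 * n + 1) * n div 2))
            * (1 - a\<^sup>2 * q ^ ((2 * \<kappa> - 3) * (2 * n + 1))))
     - K * (\<Sum>i\<in>{1..\<kappa> - 1}. T \<kappa> (int i) *
    (1 - (\<Sum>m. let n = Suc m in a ^ (2 * \<kappa> * n - 2 * i) * q powi ((2 * int \<kappa> - 3) * (int \<kappa> * int n - int i) * int n)
                    * (1 - a ^ (2 * i) * q powi (2 * (2 * int \<kappa> - 3) * int i * int n))))))"
proof -
  define N where "N = 2 * \<kappa> - 3"
  have N: "2 * int \<kappa> = int N + 3" "N > 0" "\<kappa> > 0" "6 * int k - 5 = int N"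
    using k by (auto simp: N_def of_nat_diff)
  let ?Q = "\<lambda>s. q powi (int N * (3 * tri s + 2 * s))"
  obtain X where X: "((\<lambda>s. ?Q s * R (3 * s)) has_sum X) UNIV" "((\<lambda>j. - T \<kappa> (int j)) has_sum X) UNIV"
    using theta_part_has_sum[OF N(1-3)] by blast
  have AG: "A k s * G (3 * s) = ?Q s * w (3 * s)" for s
    using A_mult_G_eq[OF k(1), of s] by (simp only: N(4))
  have w: "((\<lambda>s. ?Q s * w (3 * s)) has_sum (\<Sum>\<^sub>\<infinity>s. A k s * G (3 * s))) UNIV"
    using has_sum_infsum[OF bailey_sum_sums(2)[OF k(1)]] unfolding AG .
  \<comment> \<open>The series in \<open>e\<close> is summed as the difference of the series in
    \<open>w\<close> and \<open>R\<close>, so its convergence is inherited.\<close>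
  have "((\<lambda>s. ?Q s * w (3 * s) + - (K * (?Q s * R (3 * s)))) has_sum (\<Sum>\<^sub>\<infinity>s. A k s * G (3 * s)) + - (K * X)) UNIV"
    by (intro has_sum_add w has_sum_uminusI has_sum_cmult_right X(1))
  moreover have "?Q s * w (3 * s) + - (K * (?Q s * R (3 * s))) = ?Q s * e (3 * s)" for s
    unfolding w_decomposition by (simp add: algebra_simps)
  ultimately have e: "((\<lambda>s. ?Q s * e (3 * s)) has_sum (\<Sum>\<^sub>\<infinity>s. A k s * G (3 * s)) + - (K * X)) UNIV"
    by simp
  have Ts: "((\<lambda>j. T \<kappa> (int j)) has_sum - X) UNIV"
    using has_sum_uminusI[OF X(2)] by simp
  have "summable (\<lambda>j. norm (T \<kappa> (int j)))"
    using has_sum_imp_summable[OF Ts]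
    unfolding summable_on_iff_abs_summable_on_complex by (rule summable_on_imp_summable)
  note T = T_suminf[OF N(3) this]
  have "(\<Sum>j. T \<kappa> (int j)) = - X"
    using has_sum_imp_sums[OF Ts] by (simp add: sums_iff)
  then have "(\<Sum>\<^sub>\<infinity>s. A k s * G (3 * s)) = (\<Sum>\<^sub>\<infinity>s. ?Q s * e (3 * s)) - K * (\<Sum>j. T \<kappa> (int j))"
    using infsumI[OF e] by simp
  then show ?thesis
    using bailey_sum_sums(1)[OF k(1)] e_series[OF has_sum_imp_summable[OF e]] unfolding T N_def by (simp only:)
qed

lemma main_term:
  assumes i: "i \<in> {1..\<kappa> - 1}"
  shows "- (K * (T \<kappa> (int i) * Y)) = (-1) ^ (i + 1) * a ^ i * q ^ (i choose 2)
          * (qpochs_inf [q ^ i, q ^ (2 * \<kappa> - i), q ^ (2 * \<kappa>)] (q ^ (2 * \<kappa>))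
             * qpochs_inf [q ^ (2 * \<kappa> - 2 * i), q ^ (2 * \<kappa> + 2 * i)] (q ^ (4 * \<kappa>))
             / qpochs_inf [q, a, q / a] q) * Y"
proof -
  have "tri (int i) = int (i choose 2)"
  proof -
    have "2 * tri (int i) = 2 * int (i choose 2)"
    proof (cases i)
      case (Suc m)
      have "even (i * (i - 1))" using Suc by simp
      then have "2 * (i choose 2) = i * (i - 1)" unfolding choose_two by (rule dvd_mult_div_cancel)
      then have "2 * int (i choose 2) = int (i * (i - 1))" by (metis of_nat_mult of_nat_numeral)
      then show ?thesis unfolding two_tri using Suc by (simp add: algebra_simps)
    qed simp
    then show ?thesis by simp
  qed
  then have t: "t (int i) = q ^ (i choose 2)" by (simp only: power_int_of_nat)
  have "(- a) powi int i = (- 1) ^ i * a ^ i"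
    using power_mult_distrib[of "- 1" a i] by simp
  moreover have "1 \<le> i" "i < \<kappa>" using i by auto
  note P_eq_prod[OF this]
  ultimately show ?thesis
    unfolding T_def t by (simp add: K_def)
qed

end

theorem theorem1p4:
  fixes q a :: complex and k \<kappa> :: nat
  assumes "0 < norm q" and "norm q < 1"
    and "a \<noteq> 0" and "a \<notin> {q powi m | m :: int. True}"
    and "k \<ge> 1" and "\<kappa> = 3 * k - 1"
  shows
    "(\<lambda>n. qpoch q q (2 * int n) * q ^ n / (qpoch a q (int n + 1) * qpoch (q / a) q (int n))
          * inner_sum k q n)
     sums
     ((\<Sum>n. (-1) ^ n * a ^ (3 * n) * q ^ ((2 * \<kappa> - 3) * ((3 * n + 1) * n div 2))
            * (1 - a\<^sup>2 * q ^ ((2 * \<kappa> - 3) * (2 * n + 1))))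
      + (\<Sum>i\<in>{1..\<kappa> - 1}. (-1) ^ (i + 1) * a ^ i * q ^ (i choose 2)
          * (qpochs_inf [q ^ i, q ^ (2 * \<kappa> - i), q ^ (2 * \<kappa>)] (q ^ (2 * \<kappa>))
             * qpochs_inf [q ^ (2 * \<kappa> - 2 * i), q ^ (2 * \<kappa> + 2 * i)] (q ^ (4 * \<kappa>))
             / qpochs_inf [q, a, q / a] q)
          * (1 - (\<Sum>m. let n = Suc m in
                    a ^ (2 * \<kappa> * n - 2 * i) * q ^ ((2 * \<kappa> - 3) * (\<kappa> * n - i) * n)
                    * (1 - a ^ (2 * i) * q ^ (2 * (2 * \<kappa> - 3) * i * n))))))"
proof -
  interpret nome_param q a
    using assms(1-4) by unfold_locales auto
  have \<kappa>: "2 \<le> \<kappa>" using assms(5,6) by simp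
  \<comment> \<open>Passes to truncated natural-number exponents; this is sound because \<kappa> >=
    2 makes 2\<kappa> - 3 positive and i <= \<kappa> n for n >= 1.\<close>
  have powers: "q powi ((2 * int \<kappa> - 3) * (int \<kappa> * int n - int i) * int n) = q ^ ((2 * \<kappa> - 3) * (\<kappa> * n - i) * n)"
    "q powi (2 * (2 * int \<kappa> - 3) * int i * int n) = q ^ (2 * (2 * \<kappa> - 3) * i * n)"
    if "i \<in> {1..\<kappa> - 1}" "n = Suc m" for i n m
  proof -
    have "i \<le> \<kappa> * n"
      using that mult_le_mono[of i \<kappa> 1 n] by auto
    then have "(2 * int \<kappa> - 3) * (int \<kappa> * int n - int i) * int n = int ((2 * \<kappa> - 3) * (\<kappa> * n - i) * n)"
      "2 * (2 * int \<kappa> - 3) * int i * int n = int (2 * (2 * \<kappa> - 3) * i * n)"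
      using \<kappa> by (simp_all add: of_nat_diff)
    then show "q powi ((2 * int \<kappa> - 3) * (int \<kappa> * int n - int i) * int n) = q ^ ((2 * \<kappa> - 3) * (\<kappa> * n - i) * n)"
      "q powi (2 * (2 * int \<kappa> - 3) * int i * int n) = q ^ (2 * (2 * \<kappa> - 3) * i * n)"
      by (simp_all only: power_int_of_nat)
  qed
  have "- (K * (\<Sum>i\<in>{1..\<kappa> - 1}. T \<kappa> (int i) *
    (1 - (\<Sum>m. let n = Suc m in a ^ (2 * \<kappa> * n - 2 * i) * q powi ((2 * int \<kappa> - 3) * (int \<kappa> * int n - int i) * int n)
                    * (1 - a ^ (2 * i) * q powi (2 * (2 * int \<kappa> - 3) * int i * int n)))))) =
    (\<Sum>i\<in>{1..\<kappa> - 1}. - (K * (T \<kappa> (int i) * (1 - (\<Sum>m. let n = Suc m in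
                    a ^ (2 * \<kappa> * n - 2 * i) * q ^ ((2 * \<kappa> - 3) * (\<kappa> * n - i) * n)
                    * (1 - a ^ (2 * i) * q ^ (2 * (2 * \<kappa> - 3) * i * n)))))))"
    unfolding sum_distrib_left sum_negf Let_def
    by (intro arg_cong[where f = uminus] sum.cong refl) (simp only: powers[OF _ refl])
  also have "\<dots> = (\<Sum>i\<in>{1..\<kappa> - 1}. (-1) ^ (i + 1) * a ^ i * q ^ (i choose 2)
          * (qpochs_inf [q ^ i, q ^ (2 * \<kappa> - i), q ^ (2 * \<kappa>)] (q ^ (2 * \<kappa>))
             * qpochs_inf [q ^ (2 * \<kappa> - 2 * i), q ^ (2 * \<kappa> + 2 * i)] (q ^ (4 * \<kappa>))
             / qpochs_inf [q, a, q / a] q)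
          * (1 - (\<Sum>m. let n = Suc m in
                    a ^ (2 * \<kappa> * n - 2 * i) * q ^ ((2 * \<kappa> - 3) * (\<kappa> * n - i) * n)
                    * (1 - a ^ (2 * i) * q ^ (2 * (2 * \<kappa> - 3) * i * n)))))"
    by (intro sum.cong refl main_term)
  finally have rhs: "- (K * (\<Sum>i\<in>{1..\<kappa> - 1}. T \<kappa> (int i) *
    (1 - (\<Sum>m. let n = Suc m in a ^ (2 * \<kappa> * n - 2 * i) * q powi ((2 * int \<kappa> - 3) * (int \<kappa> * int n - int i) * int n)
                    * (1 - a ^ (2 * i) * q powi (2 * (2 * int \<kappa> - 3) * int i * int n)))))) = \<dots>" .
  show ?thesis
    using main_expansion[OF assms(5,6)] unfolding diff_conv_add_uminus[of _ "K * _"] rhs V_def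
    by (simp only: times_divide_eq_left)
qed

end
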